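(* For every $n$ and $d$ and for every ordered basis $\mathbf{p}$ of $\mathcal{V}_{n,d}$, if $\mathbf{q}$ is a Lagrange basis for $\mathcal{V}_{n,2d}$ and $\Lambda:\mathbb{R}^U\to\mathbb{S}^L$ is the linear operator associated with $\mathbf{p}$ and $\mathbf{q}$, then the gradient and Hessian of the barrier $\mathbf{x}\mapsto-\ln(\det(\Lambda(\mathbf{x})))$ can be computed in $O(LU^2)$ time, using $O(LU)$ working memory in addition to the $O(U^2)$ space required to store the Hessian. In particular, when $n=1$, these computations take $O(d^3)$ time using $O(d^2)$ space.
   Context: $\mathcal{V}_{n,r}$ is the space of real $n$-variate polynomials of total degree at most $r$; $L=\dim\mathcal{V}_{n,d}=\binom{n+d}{n}$, $U=\dim\mathcal{V}_{n,2d}=\binom{n+2d}{n}$; $\mathbb{S}^L$ is the space of real symmetric $L\times L$ matrices. For ordered bases $\mathbf{p}=(p_1,\ldots,p_L)$ of $\mathcal{V}_{n,d}$ and $\mathbf{q}=(q_1,\ldots,q_U)$ of $\mathcal{V}_{n,2d}$, $\Lambda:\mathbb{R}^U\to\mathbb{S}^L$ is the unique linear map with $\Lambda(\mathbf{q})=\mathbf{p}\mathbf{p}^{\mathrm T}$, i.e. $\Lambda(\mathbf{x})=\sum_{u=1}^U x_u\mathbf{E}_u$ where $p_ip_j=\sum_{u=1}^U(\mathbf{E}_u)_{ij}q_u$ as polynomials for all $i,j$. A set $\{\mathbf{t}_1,\ldots,\mathbf{t}_U\}\subset\mathbb{R}^n$ is unisolvent for $\mathcal{V}_{n,2d}$ if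 every polynomial in $\mathcal{V}_{n,2d}$ is uniquely determined by its values at these points; the corresponding Lagrange basis is $\mathbf{q}=(q_1,\ldots,q_U)$ with $q_u\in\mathcal{V}_{n,2d}$, $q_u(\mathbf{t}_u)=1$ and $q_u(\mathbf{t}_v)=0$ for $v\ne u$. $\Sigma_{n,2d}\subset\mathbb{R}^U$ is the cone of coefficient vectors (in the basis $\mathbf{q}$) of polynomials in $\mathcal{V}_{n,2d}$ that are finite sums of squares of polynomials in $\mathcal{V}_{n,d}$, and $\Sigma_{n,2d}^*=\{\mathbf{x}\in\mathbb{R}^U:\mathbf{s}^{\mathrm T}\mathbf{x}\ge0\ \forall\,\mathbf{s}\in\Sigma_{n,2d}\}=\{\mathbf{x}\in\mathbb{R}^U:\Lambda(\mathbf{x})\succeq0\}$ is its dual cone; the barrier is defined on the interior of $\Sigma_{n,2d}^*$, and its gradient and Hessian are evaluated at a point $\mathbf{x}$ of that interior. Time is counted in arithmetic operations. *)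

theory Defs
  imports
    "HOL-Library.Poly_Mapping"
    "HOL-Analysis.Derivative"
    "HOL-Analysis.Abstract_Euclidean_Space"
    "Jordan_Normal_Form.Determinant"
begin

text \<open>
  Vectors of dimension \<open>m\<close>, for varying \<open>m\<close>, are the points of \<^term>\<open>Euclidean_space m\<close>, that is,
  functions \<^typ>\<open>nat \<Rightarrow> real\<close> that vanish on all indices from \<open>m\<close> on. All indices start at 0.
\<close>

section \<open>Real polynomials\<close>

text \<open>
  A polynomial maps every monomial (its exponents, indexed by the variables) to its coefficient.
\<close>

type_synonym mpoly = "(nat \<Rightarrow>\<^sub>0 nat) \<Rightarrow>\<^sub>0 real"

definition total_deg :: "(nat \<Rightarrow>\<^sub>0 nat) \<Rightarrow> nat" where
  "total_deg m = (\<Sum>i \<in> Poly_Mapping.keys m. Poly_Mapping.lookup m i)"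

definition polys :: "nat \<Rightarrow> nat \<Rightarrow> mpoly set" where
  "polys n r = {f. \<forall>m \<in> Poly_Mapping.keys f. Poly_Mapping.keys m \<subseteq> {..<n} \<and> total_deg m \<le> r}"

definition peval :: "mpoly \<Rightarrow> (nat \<Rightarrow> real) \<Rightarrow> real" where
  "peval f t = (\<Sum>m \<in> Poly_Mapping.keys f. Poly_Mapping.lookup f m *
     (\<Prod>i \<in> Poly_Mapping.keys m. t i ^ Poly_Mapping.lookup m i))"

definition psmult :: "real \<Rightarrow> mpoly \<Rightarrow> mpoly" where
  "psmult c f = Poly_Mapping.single 0 c * f"

global_interpretation mpoly: vector_space psmult
  by unfold_locales
    (simp_all add: psmult_def distrib_left distrib_right single_add mult_single
      flip: mult.assoc)

definition dimP :: "nat \<Rightarrow> nat \<Rightarrow> nat" where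
  "dimP n r = (n + r) choose n"

definition ordered_basis :: "nat \<Rightarrow> nat \<Rightarrow> mpoly list \<Rightarrow> bool" where
  "ordered_basis n r bs \<longleftrightarrow> length bs = dimP n r \<and> distinct bs \<and>
     mpoly.independent (set bs) \<and> mpoly.span (set bs) = polys n r"

definition unisolvent :: "nat \<Rightarrow> nat \<Rightarrow> (nat \<Rightarrow> real) set \<Rightarrow> bool" where
  "unisolvent n r T \<longleftrightarrow> T \<subseteq> topspace (Euclidean_space n) \<and>
     (\<forall>f \<in> polys n r. \<forall>g \<in> polys n r. (\<forall>t \<in> T. peval f t = peval g t) \<longrightarrow> f = g)"

definition lagrange_basis :: "nat \<Rightarrow> nat \<Rightarrow> (nat \<Rightarrow> real) list \<Rightarrow> mpoly list \<Rightarrow> bool" where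
  "lagrange_basis n r ts qs \<longleftrightarrow>
     length ts = dimP n r \<and> distinct ts \<and> unisolvent n r (set ts) \<and>
     length qs = dimP n r \<and> set qs \<subseteq> polys n r \<and>
     (\<forall>u < length qs. \<forall>v < length ts. peval (qs ! u) (ts ! v) = (if v = u then 1 else 0))"

section \<open>The cone, its dual and the barrier\<close>

text \<open>
  \<^term>\<open>mpoly.representation B f b\<close> is the coordinate of \<open>f\<close> at the element \<open>b\<close> of the basis \<open>B\<close>.
  Hence the matrix entries of \<open>E\<^sub>u\<close> are the coordinates at \<open>q\<^sub>u\<close> of the products \<open>p\<^sub>i p\<^sub>j\<close>.
\<close>

definition Lambda_coeff :: "mpoly list \<Rightarrow> mpoly list \<Rightarrow> nat \<Rightarrow> real mat" where
  "Lambda_coeff ps qs u = mat (length ps) (length ps)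
     (\<lambda>(i, j). mpoly.representation (set qs) (ps ! i * ps ! j) (qs ! u))"

definition Lambda :: "mpoly list \<Rightarrow> mpoly list \<Rightarrow> (nat \<Rightarrow> real) \<Rightarrow> real mat" where
  "Lambda ps qs x = mat (length ps) (length ps)
     (\<lambda>(i, j). \<Sum>u < length qs. x u * Lambda_coeff ps qs u $$ (i, j))"

definition sos_cone :: "nat \<Rightarrow> nat \<Rightarrow> mpoly list \<Rightarrow> (nat \<Rightarrow> real) set" where
  "sos_cone n d qs = {s \<in> topspace (Euclidean_space (length qs)).
     \<exists>gs. set gs \<subseteq> polys n d \<and>
       (\<Sum>u < length qs. psmult (s u) (qs ! u)) = (\<Sum>g \<leftarrow> gs. g ^ 2)}"

definition dual_cone :: "nat \<Rightarrow> (nat \<Rightarrow> real) set \<Rightarrow> (nat \<Rightarrow> real) set" where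
  "dual_cone m K = {x \<in> topspace (Euclidean_space m). \<forall>s \<in> K. 0 \<le> (\<Sum>u < m. s u * x u)}"

text \<open>
  The barrier is meaningful only on the interior of the dual cone; outside of it the value of this
  total function is irrelevant, as derivatives at interior points depend on nearby points only.
\<close>

definition barrier :: "mpoly list \<Rightarrow> mpoly list \<Rightarrow> (nat \<Rightarrow> real) \<Rightarrow> real" where
  "barrier ps qs x = - ln (Determinant.det (Lambda ps qs x))"

definition partial_deriv :: "nat \<Rightarrow> ((nat \<Rightarrow> real) \<Rightarrow> real) \<Rightarrow> (nat \<Rightarrow> real) \<Rightarrow> real" where
  "partial_deriv u f x = deriv (\<lambda>s. f (x(u := s))) (x u)"

definition has_gradient ::
  "nat \<Rightarrow> ((nat \<Rightarrow> real) \<Rightarrow> real) \<Rightarrow> (nat \<Rightarrow> real) \<Rightarrow> (nat \<Rightarrow> real) \<Rightarrow> bool" where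
  "has_gradient m f x g \<longleftrightarrow>
     (\<forall>u < m. ((\<lambda>s. f (x(u := s))) has_real_derivative g u) (at (x u)))"

definition has_hessian ::
  "nat \<Rightarrow> ((nat \<Rightarrow> real) \<Rightarrow> real) \<Rightarrow> (nat \<Rightarrow> real) \<Rightarrow> (nat \<Rightarrow> nat \<Rightarrow> real) \<Rightarrow> bool" where
  "has_hessian m f x H \<longleftrightarrow> (\<forall>u < m. \<forall>v < m.
     ((\<lambda>s. partial_deriv v f (x(u := s))) has_real_derivative H u v) (at (x u)))"

section \<open>Machine model\<close>

text \<open>
  A real random access machine, restricted to counting loops: it has real memory cells, addressed by
  natural numbers, and index registers, which hold natural numbers and serve as loop counters and
  addresses. Every operand of a real operation is given by the index register holding its address.
  Real data do not influence the control flow, and numbers cannot be moved between the index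
  registers and the memory; real constants are integers fixed in the program.

  Every executed operation takes one time step, be it on real numbers, on index registers, or for
  the administration of a loop. So the number of steps bounds the number of arithmetic operations.
  The memory consumption is given by the set of cells that are ever read or written. A program
  mentions a fixed finite number of index registers. Division by zero is a fault.
\<close>

datatype arith_op = Addition | Subtraction | Multiplication | Division

datatype program =
    Index_Const nat nat
  | Index_Add nat nat nat
  | Index_Mult nat nat nat
  | Real_Const nat int
  | Real_Op arith_op nat nat nat
  | Seq program program
  | Loop nat nat program

record machine_state =
  index :: "nat \<Rightarrow> nat"
  memory :: "nat \<Rightarrow> real"
  cells :: "nat set"
  steps :: nat
  faulted :: bool

primrec apply_op :: "arith_op \<Rightarrow> real \<Rightarrow> real \<Rightarrow> real" where
  "apply_op Addition a b = a + b"
| "apply_op Subtraction a b = a - b"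
| "apply_op Multiplication a b = a * b"
| "apply_op Division a b = a / b"

definition set_index :: "nat \<Rightarrow> nat \<Rightarrow> machine_state \<Rightarrow> machine_state" where
  "set_index r k s = s\<lparr>index := (index s)(r := k), steps := steps s + 1\<rparr>"

text \<open>
  \<^term>\<open>Loop r b c\<close> executes \<open>c\<close> with register \<open>r\<close> set to \<open>0, 1, \<dots>\<close> up to, but excluding, the value
  that register \<open>b\<close> has on entry; entering the loop takes one step as well.
\<close>

primrec exec :: "program \<Rightarrow> machine_state \<Rightarrow> machine_state" where
  "exec (Index_Const r k) = (\<lambda>s. set_index r k s)"
| "exec (Index_Add r a b) = (\<lambda>s. set_index r (index s a + index s b) s)"
| "exec (Index_Mult r a b) = (\<lambda>s. set_index r (index s a * index s b) s)"
| "exec (Real_Const r z) = (\<lambda>s. s\<lparr>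
     memory := (memory s)(index s r := of_int z),
     cells := insert (index s r) (cells s),
     steps := steps s + 1\<rparr>)"
| "exec (Real_Op f r a b) = (\<lambda>s. s\<lparr>
     memory := (memory s)(index s r :=
       apply_op f (memory s (index s a)) (memory s (index s b))),
     cells := cells s \<union> {index s r, index s a, index s b},
     steps := steps s + 1,
     faulted := (faulted s \<or> f = Division \<and> memory s (index s b) = 0)\<rparr>)"
| "exec (Seq c1 c2) = (\<lambda>s. exec c2 (exec c1 s))"
| "exec (Loop r b c) = (\<lambda>s. fold (\<lambda>k s'. exec c (set_index r k s')) [0..<index s b]
     (s\<lparr>steps := steps s + 1\<rparr>))"

text \<open>
  Initially registers 0 and 1 hold \<open>L\<close> and \<open>U\<close>, the other registers 0. The memory contains, from
  cell 0 on, the coordinates of every \<open>p\<^sub>i\<close> in the basis \<open>q\<close> (which determine \<open>\<Lambda>\<close> since \<open>q\<close> is a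
  Lagrange basis), followed by the \<open>U\<close> coordinates of \<open>x\<close>. The content of all other cells is
  arbitrary, so a program cannot rely on it.
\<close>

definition initial_state ::
  "mpoly list \<Rightarrow> mpoly list \<Rightarrow> (nat \<Rightarrow> real) \<Rightarrow> machine_state \<Rightarrow> bool" where
  "initial_state ps qs x s \<longleftrightarrow> (let L = length ps; U = length qs in
     index s = (\<lambda>_. 0)(0 := L, 1 := U) \<and>
     (\<forall>i < L. \<forall>u < U. memory s (i * U + u) = mpoly.representation (set qs) (ps ! i) (qs ! u)) \<and>
     (\<forall>u < U. memory s (L * U + u) = x u) \<and>
     cells s = {} \<and> steps s = 0 \<and> \<not> faulted s)"

text \<open>
  The gradient is stored directly after the input, and then the Hessian, row by row.
\<close>

definition output_gradient :: "nat \<Rightarrow> nat \<Rightarrow> machine_state \<Rightarrow> nat \<Rightarrow> real" where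
  "output_gradient L U s u = memory s (L * U + U + u)"

definition output_hessian :: "nat \<Rightarrow> nat \<Rightarrow> machine_state \<Rightarrow> nat \<Rightarrow> nat \<Rightarrow> real" where
  "output_hessian L U s u v = memory s (L * U + 2 * U + u * U + v)"

text \<open>
  The cells used are counted by requiring that their addresses lie below \<open>space\<close>; this includes the
  cells of the input and of the output.
\<close>

definition computes_derivatives ::
  "program \<Rightarrow> nat \<Rightarrow> nat \<Rightarrow> mpoly list \<Rightarrow> mpoly list \<Rightarrow> nat \<Rightarrow> nat \<Rightarrow> bool" where
  "computes_derivatives prog n d ps qs time space \<longleftrightarrow> (let L = length ps; U = length qs in
     \<forall>x \<in> Euclidean_space U interior_of dual_cone U (sos_cone n d qs).
     \<forall>s. initial_state ps qs x s \<longrightarrow>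
       (let s' = exec prog s in
          \<not> faulted s' \<and>
          has_gradient U (barrier ps qs) x (output_gradient L U s') \<and>
          has_hessian U (barrier ps qs) x (output_hessian L U s') \<and>
          steps s' \<le> time \<and> cells s' \<subseteq> {..<space}))"

end

theory Submission
  imports Defs
begin

text \<open>
  Let \<open>P\<close> be the matrix of the values of the \<open>p\<^sub>i\<close> at the interpolation points. Since \<open>q\<close> is a Lagrange
  basis, \<open>\<Lambda>(x) = P diag(x) P\<^sup>T\<close>. Changing one coordinate of \<open>x\<close> is a rank-one update of \<open>\<Lambda>(x)\<close>, so by the
  matrix determinant lemma and the Sherman--Morrison formula the gradient and the Hessian of the
  barrier have the entries \<open>- K\<^sub>u\<^sub>u\<close> and \<open>K\<^sub>u\<^sub>v\<^sup>2\<close> with \<open>K = P\<^sup>T \<Lambda>(x)\<^sup>-\<^sup>1 P\<close>.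

  This \<open>K\<close> is the reproducing kernel of the row space of \<open>P\<close> for the inner product with weights \<open>x\<close>,
  and it is obtained without inverting \<open>\<Lambda>(x)\<close> by adding the rows of \<open>P\<close> one at a time: if \<open>K\<close> is the
  kernel of the first \<open>i\<close> rows, then \<open>w = p\<^sub>i - K diag(x) p\<^sub>i\<close> is orthogonal to them, and
  \<open>K + w w\<^sup>T / \<langle>w, w\<rangle>\<close> is the kernel of the first \<open>i + 1\<close> rows. Each of the \<open>L\<close> rows takes \<open>O(U\<^sup>2)\<close>
  steps, and \<open>K\<close> can be kept in the cells of the Hessian. On the interior of the dual cone \<open>\<langle>w, w\<rangle>\<close> is
  positive, so that no division by zero occurs.
\<close>

section \<open>Derivatives of the log-determinant of a weighted Gram matrix\<close>

text \<open>The bordered matrix \<open>?E\<close> is reduced in two ways by block triangular factors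
  of determinant 1: clearing the lower left block leaves the scalar \<open>?N\<close>, and splitting
  off a factor on the left leaves \<open>?M\<close>.\<close>

lemma det_one_plus_outer:
  fixes a b :: "nat \<Rightarrow> 'a :: idom"
  shows "Determinant.det (mat n n (\<lambda>(i, j). (if i = j then 1 else 0) + a i * b j)) =
    1 + (\<Sum>i<n. b i * a i)"
proof -
  let ?A = "mat n 1 (\<lambda>(i, j). a i)" and ?A' = "mat n 1 (\<lambda>(i, j). - a i)"
  let ?B = "mat 1 n (\<lambda>(i, j). b j)"
  let ?M = "mat n n (\<lambda>(i, j). (if i = j then 1 else 0) + a i * b j)"
  let ?N = "mat 1 1 (\<lambda>_. 1 + (\<Sum>i<n. b i * a i))"
  let ?E = "four_block_mat (1\<^sub>m 1) ?B ?A' (1\<^sub>m n)"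
  have 1: "?E * four_block_mat (1\<^sub>m 1) (0\<^sub>m 1 n) ?A (1\<^sub>m n) = four_block_mat ?N ?B (0\<^sub>m n 1) (1\<^sub>m n)"
    by (subst mult_four_block_mat[where ?nr1.0 = 1 and ?nr2.0 = n and ?n1.0 = 1 and ?n2.0 = n])
      (auto intro!: cong_four_block_mat eq_matI simp: scalar_prod_def atLeast0LessThan)
  have 2: "four_block_mat (1\<^sub>m 1) (0\<^sub>m 1 n) ?A' (1\<^sub>m n) * four_block_mat (1\<^sub>m 1) ?B (0\<^sub>m n 1) ?M = ?E"
    by (subst mult_four_block_mat[where ?nr1.0 = 1 and ?nr2.0 = n and ?n1.0 = 1 and ?n2.0 = n])
      (auto intro!: cong_four_block_mat eq_matI simp: scalar_prod_def)
  have "Determinant.det ?E = Determinant.det ?N"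
    using arg_cong[OF 1, of Determinant.det]
    by (subst (asm) det_mult[where n = "1 + n"])
      (auto simp: det_four_block_mat_upper_right_zero[where n = 1 and m = n]
        det_four_block_mat_lower_left_zero[where n = 1 and m = n])
  moreover have "Determinant.det ?E = Determinant.det ?M"
    using arg_cong[OF 2, of Determinant.det]
    by (subst (asm) det_mult[where n = "1 + n"])
      (auto simp: det_four_block_mat_upper_right_zero[where n = 1 and m = n]
        det_four_block_mat_lower_left_zero[where n = 1 and m = n])
  ultimately show ?thesis
    by (simp add: det_single)
qed

text \<open>The determinant does not vanish on the segment from the identity matrix to \<open>A\<close>.\<close>

lemma det_pos_if_pos_def:
  fixes A :: "nat \<Rightarrow> nat \<Rightarrow> real"
  assumes pd: "\<And>c. \<exists>i<n. c i \<noteq> 0 \<Longrightarrow> 0 < (\<Sum>i<n. c i * (\<Sum>j<n. A i j * c j))"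
  shows "0 < Determinant.det (mat n n (\<lambda>(i, j). A i j))"
proof -
  define M where "M t = mat n n (\<lambda>(i, j). (1 - t) * (if i = j then 1 else 0) + t * A i j)" for t
  have carrier: "M t \<in> carrier_mat n n" for t
    by (simp add: M_def)
  \<comment> \<open>A kernel vector \<open>v\<close> of \<open>M t\<close> would make the quadratic
    form of \<open>M t\<close> vanish at \<open>v\<close>, but this form is a convex combination of
    the squared length of \<open>v\<close> and the form of \<open>A\<close>, both positive.\<close>
  have nz: "Determinant.det (M t) \<noteq> 0" if t: "0 \<le> t" "t \<le> 1" for t
  proof
    assume "Determinant.det (M t) = 0"
    then obtain v where v: "v \<in> carrier_vec n" "v \<noteq> 0\<^sub>v n" "M t *\<^sub>v v = 0\<^sub>v n"
      using det_0_iff_vec_prod_zero[OF carrier] by blast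
    have ex: "\<exists>i<n. v $ i \<noteq> 0"
      using v(1,2) by auto
    have row: "(\<Sum>j<n. ((1 - t) * (if i = j then 1 else 0) + t * A i j) * v $ j) = 0" if "i < n" for i
      using arg_cong[OF v(3), of "\<lambda>w. w $ i"] that v(1)
      by (auto simp: M_def scalar_prod_def atLeast0LessThan)
    have row': "(1 - t) * v $ i + t * (\<Sum>j<n. A i j * v $ j) = 0" if "i < n" for i
    proof -
      have "((1 - t) * (if i = j then 1 else 0) + t * A i j) * v $ j =
          (if i = j then (1 - t) * v $ i else 0) + t * (A i j * v $ j)" for j
        by (simp add: algebra_simps)
      then show ?thesis
        using row[OF that] that by (simp add: sum.distrib sum_distrib_left)
    qed
    have "0 = (\<Sum>i<n. v $ i * ((1 - t) * v $ i + t * (\<Sum>j<n. A i j * v $ j)))"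
      by (simp add: row')
    also have "\<dots> = (1 - t) * (\<Sum>i<n. v $ i * v $ i) + t * (\<Sum>i<n. v $ i * (\<Sum>j<n. A i j * v $ j))"
      by (simp add: distrib_left sum.distrib sum_distrib_left mult_ac)
    also have "\<dots> > 0"
    proof (cases "t = 0")
      case True
      have "0 < (\<Sum>i<n. v $ i * v $ i)"
        using ex by (auto intro!: sum_pos2 simp: zero_less_mult_iff linorder_neq_iff)
      then show ?thesis
        using True by simp
    next
      case False
      then have "0 < t * (\<Sum>i<n. v $ i * (\<Sum>j<n. A i j * v $ j))"
        using t pd[OF ex] by simp
      moreover have "0 \<le> (1 - t) * (\<Sum>i<n. v $ i * v $ i)"
        using t by (simp add: sum_nonneg)
      ultimately show ?thesis
        by linarith
    qed
    finally show False
      by simp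
  qed
  have "continuous_on {0..1} (\<lambda>t. Determinant.det (M t))"
  proof -
    have "continuous_on {0..1} (\<lambda>t. M t $$ (i, j))" if "i < n" "j < n" for i j
      using that by (auto simp: M_def intro!: continuous_intros)
    then show ?thesis
      unfolding det_def'[OF carrier]
      by (intro continuous_intros) (auto simp: permutes_in_image)
  qed
  moreover have M0: "M 0 = 1\<^sub>m n"
    by (auto simp: M_def)
  \<comment> \<open>The determinant is 1 at \<open>t = 0\<close>, so a nonpositive value at
    \<open>t = 1\<close> would force a zero in between.\<close>
  ultimately have "0 < Determinant.det (M 1)"
    using IVT2'[of "\<lambda>t. Determinant.det (M t)" 1 0 0] nz
    by (force simp: not_less[symmetric])
  moreover have "M 1 = mat n n (\<lambda>(i, j). A i j)"
    by (auto simp: M_def)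
  ultimately show ?thesis
    by simp
qed

section \<open>Weighted Gram matrices and their reproducing kernels\<close>

definition gram :: "nat \<Rightarrow> nat \<Rightarrow> (nat \<Rightarrow> nat \<Rightarrow> real) \<Rightarrow> (nat \<Rightarrow> real) \<Rightarrow> real mat" where
  "gram L U P x = mat L L (\<lambda>(i, j). \<Sum>u<U. x u * P i u * P j u)"

text \<open>Positive definiteness of \<open>gram L U P x\<close>, with the quadratic form written as
  a weighted sum of squares; in this shape it comes directly from the dual cone. Single weights
  \<open>x u\<close> may be negative.\<close>

definition pos_def :: "nat \<Rightarrow> nat \<Rightarrow> (nat \<Rightarrow> nat \<Rightarrow> real) \<Rightarrow> (nat \<Rightarrow> real) \<Rightarrow> bool" where
  "pos_def L U P x \<longleftrightarrow>
     (\<forall>c. (\<exists>i<L. c i \<noteq> 0) \<longrightarrow> 0 < (\<Sum>u<U. x u * (\<Sum>i<L. c i * P i u)\<^sup>2))"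

lemma det_gram_pos:
  assumes "pos_def L U P x"
  shows "0 < Determinant.det (gram L U P x)"
  unfolding gram_def
proof (rule det_pos_if_pos_def)
  fix c :: "nat \<Rightarrow> real"
  assume "\<exists>i<L. c i \<noteq> 0"
  then have "0 < (\<Sum>u<U. x u * (\<Sum>i<L. c i * P i u)\<^sup>2)"
    using assms by (auto simp: pos_def_def)
  also have "\<dots> = (\<Sum>u<U. \<Sum>i<L. \<Sum>j<L. c i * (x u * P i u * P j u * c j))"
    by (simp add: power2_eq_square sum_product sum_distrib_left mult_ac)
  also have "\<dots> = (\<Sum>i<L. \<Sum>j<L. \<Sum>u<U. c i * (x u * P i u * P j u * c j))"
    by (subst sum.swap) (intro sum.cong refl sum.swap)
  also have "\<dots> = (\<Sum>i<L. c i * (\<Sum>j<L. (\<Sum>u<U. x u * P i u * P j u) * c j))"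
    by (simp add: sum_distrib_left sum_distrib_right)
  finally show "0 < (\<Sum>i<L. c i * (\<Sum>j<L. (\<Sum>u<U. x u * P i u * P j u) * c j))" .
qed

text \<open>
  \<open>K\<close> is the reproducing kernel of the span of the first \<open>L\<close> rows of \<open>P\<close> with respect to the
  bilinear form with weights \<open>x\<close>; if the Gram matrix is invertible, then
  \<open>K = P\<^sup>T (P diag(x) P\<^sup>T)\<^sup>-\<^sup>1 P\<close>.
\<close>

definition is_kernel ::
  "nat \<Rightarrow> nat \<Rightarrow> (nat \<Rightarrow> nat \<Rightarrow> real) \<Rightarrow> (nat \<Rightarrow> real) \<Rightarrow> (nat \<Rightarrow> nat \<Rightarrow> real) \<Rightarrow> bool" where
  "is_kernel L U P x K \<longleftrightarrow>
     (\<exists>C. \<forall>u<U. \<forall>v<U. K u v = (\<Sum>i<L. C u i * P i v)) \<and>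
     (\<forall>u<U. \<forall>i<L. (\<Sum>v<U. K u v * x v * P i v) = P i u) \<and>
     (\<forall>u<U. \<forall>v<U. K u v = K v u)"

lemma is_kernel_obtain:
  assumes "is_kernel L U P x K"
  obtains C where "\<And>u v. u < U \<Longrightarrow> v < U \<Longrightarrow> K u v = (\<Sum>i<L. C u i * P i v)"
proof -
  obtain C where "\<forall>u<U. \<forall>v<U. K u v = (\<Sum>i<L. C u i * P i v)"
    using assms unfolding is_kernel_def by (elim conjE exE)
  then show thesis
    by (intro that[of C]) simp
qed

lemma is_kernel_reproducing:
  "is_kernel L U P x K \<Longrightarrow> u < U \<Longrightarrow> i < L \<Longrightarrow> (\<Sum>v<U. K u v * x v * P i v) = P i u"
  unfolding is_kernel_def by blast

lemma is_kernel_sym: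
  "is_kernel L U P x K \<Longrightarrow> u < U \<Longrightarrow> v < U \<Longrightarrow> K u v = K v u"
  unfolding is_kernel_def by blast

lemma sum_fun_upd:
  fixes x :: "nat \<Rightarrow> real"
  assumes "u < U"
  shows "(\<Sum>v<U. (x(u := x u + t)) v * f v) = (\<Sum>v<U. x v * f v) + t * f u"
proof -
  have "(\<Sum>v<U. (x(u := x u + t)) v * f v) = (\<Sum>v<U. x v * f v + (if v = u then t * f u else 0))"
    by (intro sum.cong) (auto simp: algebra_simps)
  then show ?thesis
    using assms by (simp add: sum.distrib)
qed

text \<open>Sherman--Morrison formula.\<close>

lemma is_kernel_update:
  assumes K: "is_kernel L U P x K" and u: "u < U" and nz: "1 + t * K u u \<noteq> 0"
  shows "is_kernel L U P (x(u := x u + t)) (\<lambda>v w. K v w - t * K v u * K u w / (1 + t * K u u))"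
    (is "is_kernel L U P ?x ?K")
  unfolding is_kernel_def
proof (intro conjI allI impI)
  obtain C where C: "\<And>v w. v < U \<Longrightarrow> w < U \<Longrightarrow> K v w = (\<Sum>i<L. C v i * P i w)"
    using is_kernel_obtain[OF K] by blast
  have rep: "(\<Sum>v<U. x v * (K w v * P i v)) = P i w" if "w < U" "i < L" for w i
    using is_kernel_reproducing[OF K that] by (simp add: mult_ac)
  note sym = is_kernel_sym[OF K]
  show "\<exists>C. \<forall>v<U. \<forall>w<U. ?K v w = (\<Sum>i<L. C v i * P i w)"
  \<comment> \<open>The update subtracts a multiple of row \<open>u\<close> of \<open>K\<close> from
    row \<open>v\<close>, so the coefficient vectors change in the same way.\<close>
  proof (intro exI[of _ "\<lambda>v i. C v i - t * K v u / (1 + t * K u u) * C u i"] allI impI)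
    fix v w
    assume "v < U" "w < U"
    moreover have "(\<Sum>i<L. (C v i - k * C u i) * P i w) =
        (\<Sum>i<L. C v i * P i w) - k * (\<Sum>i<L. C u i * P i w)" for k
      by (simp add: sum_subtractf sum_distrib_left left_diff_distrib mult.assoc)
    ultimately show "?K v w = (\<Sum>i<L. (C v i - t * K v u / (1 + t * K u u) * C u i) * P i w)"
      using u by (simp only: flip: C) simp
  qed
  show "(\<Sum>v<U. ?K w v * ?x v * P i v) = P i w" if w: "w < U" and i: "i < L" for w i
  proof -
    have "(\<Sum>v<U. ?K w v * ?x v * P i v) = (\<Sum>v<U. ?x v * (?K w v * P i v))"
      by (simp add: mult_ac)
    also have "\<dots> = (\<Sum>v<U. x v * (?K w v * P i v)) + t * (?K w u * P i u)"
      by (rule sum_fun_upd[OF u])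
    also have "(\<Sum>v<U. x v * (?K w v * P i v)) =
      (\<Sum>v<U. x v * (K w v * P i v)) - t * K w u / (1 + t * K u u) * (\<Sum>v<U. x v * (K u v * P i v))"
      by (simp add: left_diff_distrib right_diff_distrib sum_subtractf sum_distrib_left mult_ac)
    finally have "(\<Sum>v<U. ?K w v * ?x v * P i v) =
        P i w - t * K w u / (1 + t * K u u) * P i u +
        t * ((K w u - t * K w u * K u u / (1 + t * K u u)) * P i u)"
      by (simp only: rep w u i)
    \<comment> \<open>With this simplification the two multiples of \<open>P i u\<close> cancel, and
      \<open>P i w\<close> remains.\<close>
    also have "K w u - t * K w u * K u u / (1 + t * K u u) = K w u / (1 + t * K u u)"
      using nz by (simp add: field_simps)
    finally show ?thesis
      by simp
  qed
  show "?K v w = ?K w v" if "v < U" "w < U" for v w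
    using sym[OF that] sym[OF that(1) u] sym[OF u that(2)] by (simp add: mult_ac)
qed

text \<open>The coefficients \<open>C u\<close> of row \<open>u\<close> of \<open>K\<close> solve
  the linear system with the Gram matrix and right-hand side column \<open>u\<close> of
  \<open>P\<close>. Hence the updated Gram matrix is the old one times the identity plus a rank-one
  matrix, whose determinant is \<open>1 + t * K u u\<close>.\<close>

lemma det_gram_update:
  assumes K: "is_kernel L U P x K" and u: "u < U"
  shows "Determinant.det (gram L U P (x(u := x u + t))) =
    Determinant.det (gram L U P x) * (1 + t * K u u)"
proof -
  obtain C where C: "\<And>v w. v < U \<Longrightarrow> w < U \<Longrightarrow> K v w = (\<Sum>i<L. C v i * P i w)"
    using is_kernel_obtain[OF K] by blast
  note rep = is_kernel_reproducing[OF K]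
  let ?M = "mat L L (\<lambda>(i, j). (if i = j then 1 else 0) + t * C u i * P j u)"
  have solve: "(\<Sum>k<L. (\<Sum>v<U. x v * P i v * P k v) * C u k) = P i u" if "i < L" for i
  proof -
    have "(\<Sum>k<L. (\<Sum>v<U. x v * P i v * P k v) * C u k) =
      (\<Sum>v<U. \<Sum>k<L. C u k * P k v * x v * P i v)"
      unfolding sum_distrib_right by (subst sum.swap) (simp add: mult_ac)
    also have "\<dots> = (\<Sum>v<U. K u v * x v * P i v)"
      by (simp add: C u sum_distrib_right)
    finally show ?thesis
      using rep[OF u that] by simp
  qed
  have "gram L U P (x(u := x u + t)) = gram L U P x * ?M"
  proof (intro eq_matI)
    fix i j
    assume "i < dim_row (gram L U P x * ?M)" "j < dim_col (gram L U P x * ?M)"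
    then have ij: "i < L" "j < L"
      by (auto simp: gram_def)
    have "(gram L U P x * ?M) $$ (i, j) =
      (\<Sum>k<L. (\<Sum>v<U. x v * P i v * P k v) * ((if k = j then 1 else 0) + t * C u k * P j u))"
      using ij by (simp add: gram_def scalar_prod_def atLeast0LessThan)
    also have "\<dots> = (\<Sum>v<U. x v * P i v * P j v) +
      t * P j u * (\<Sum>k<L. (\<Sum>v<U. x v * P i v * P k v) * C u k)"
    proof -
      have "f k * ((if k = j then 1 else 0) + t * C u k * P j u) =
          (if k = j then f k else 0) + t * P j u * (f k * C u k)" for k and f :: "nat \<Rightarrow> real"
        by (simp add: algebra_simps)
      note * = this[of "\<lambda>k. \<Sum>v<U. x v * P i v * P k v"]
      show ?thesis
        unfolding * sum.distrib using ij by (simp add: sum_distrib_left)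
    qed
    also have "\<dots> = (\<Sum>v<U. x v * P i v * P j v) + t * P j u * P i u"
      by (simp only: solve[OF ij(1)])
    also have "\<dots> = (\<Sum>v<U. x v * (P i v * P j v)) + t * (P i u * P j u)"
      by (simp add: mult_ac)
    also have "\<dots> = (\<Sum>v<U. (x(u := x u + t)) v * (P i v * P j v))"
      by (rule sum_fun_upd[OF u, symmetric])
    also have "\<dots> = gram L U P (x(u := x u + t)) $$ (i, j)"
      using ij by (simp add: gram_def mult.assoc del: fun_upd_apply)
    finally show "gram L U P (x(u := x u + t)) $$ (i, j) = (gram L U P x * ?M) $$ (i, j)"
      by simp
  qed (simp_all add: gram_def)
  moreover have "Determinant.det ?M = 1 + (\<Sum>i<L. P i u * (t * C u i))"
    by (rule det_one_plus_outer)
  ultimately show ?thesis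
    by (simp add: det_mult[where n = L] gram_def C u sum_distrib_left mult_ac)
qed

text \<open>Near \<open>a\<close> the Sherman--Morrison denominators stay positive, so the formula
  for a partial derivative holds on a whole neighbourhood and can be differentiated again.\<close>

lemma eventually_pos_affine:
  "\<forall>\<^sub>F s in nhds a. 0 < 1 + (s - a) * (k :: real)"
proof -
  have "((\<lambda>s. 1 + (s - a) * k) \<longlongrightarrow> 1 + (a - a) * k) (nhds a)"
    by (intro tendsto_intros filterlim_ident)
  then show ?thesis
    by (auto dest: order_tendstoD(1)[of _ _ _ 0])
qed

text \<open>The determinant is affine in coordinate \<open>u\<close>, with value \<open>?D\<close>
  and slope \<open>?D * K u u\<close> at \<open>x u\<close>.\<close>

lemma has_derivative_ln_det_gram:
  assumes K: "is_kernel L U P x K" and u: "u < U" and pos: "0 < Determinant.det (gram L U P x)"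
  shows "((\<lambda>s. - ln (Determinant.det (gram L U P (x(u := s))))) has_real_derivative - K u u) (at (x u))"
proof -
  let ?D = "Determinant.det (gram L U P x)"
  have "((\<lambda>s. - ln (?D * (1 + (s - x u) * K u u))) has_real_derivative - K u u) (at (x u))"
    using pos by (auto intro!: derivative_eq_intros)
  moreover have "Determinant.det (gram L U P (x(u := s))) = ?D * (1 + (s - x u) * K u u)" for s
    using det_gram_update[OF K u, of "s - x u"] by simp
  ultimately show ?thesis
    by simp
qed

text \<open>For the Hessian, \<open>K v v\<close> is replaced by its Sherman--Morrison update in
  coordinate \<open>u\<close>. The derivative of this update at \<open>s = x u\<close> is
  \<open>- K v u * K u v\<close>, and symmetry makes the product a square.\<close>

lemma gradient_hessian:
  assumes K: "is_kernel L U P x K" and pos: "0 < Determinant.det (gram L U P x)"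
    and f: "f = (\<lambda>x. - ln (Determinant.det (gram L U P x)))"
  shows "has_gradient U f x (\<lambda>u. - K u u)" and "has_hessian U f x (\<lambda>u v. (K u v)\<^sup>2)"
proof -
  show "has_gradient U f x (\<lambda>u. - K u u)"
    using has_derivative_ln_det_gram[OF K _ pos] by (simp add: has_gradient_def f)
  show "has_hessian U f x (\<lambda>u v. (K u v)\<^sup>2)"
    unfolding has_hessian_def
  proof (intro allI impI)
    fix u v
    assume u: "u < U" and v: "v < U"
    have sym: "K v u = K u v"
      using K v u by (rule is_kernel_sym)
    have partial: "partial_deriv v f (x(u := s)) =
        - (K v v - (s - x u) * K v u * K u v / (1 + (s - x u) * K u u))"
      if s: "0 < 1 + (s - x u) * K u u" for s
    proof -
      have K': "is_kernel L U P (x(u := s))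
          (\<lambda>v w. K v w - (s - x u) * K v u * K u w / (1 + (s - x u) * K u u))"
        using is_kernel_update[OF K u, of "s - x u"] s by simp
      have pos': "0 < Determinant.det (gram L U P (x(u := s)))"
        using det_gram_update[OF K u, of "s - x u"] s pos by simp
      show ?thesis
        unfolding partial_deriv_def f
        using has_derivative_ln_det_gram[OF K' v pos'] by (rule DERIV_imp_deriv)
    qed
    have "((\<lambda>s. - (K v v - (s - x u) * K v u * K u v / (1 + (s - x u) * K u u)))
        has_real_derivative (K u v)\<^sup>2) (at (x u))"
      by (auto intro!: derivative_eq_intros simp: sym power2_eq_square)
    moreover have "\<forall>\<^sub>F s in nhds (x u). partial_deriv v f (x(u := s)) =
        - (K v v - (s - x u) * K v u * K u v / (1 + (s - x u) * K u u))"
      using eventually_pos_affine by (rule eventually_mono) (rule partial)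
    ultimately show "((\<lambda>s. partial_deriv v f (x(u := s))) has_real_derivative (K u v)\<^sup>2) (at (x u))"
      by (simp only: DERIV_cong_ev[OF refl _ refl])
  qed
qed

section \<open>Accumulating the kernel row by row\<close>

lemma is_kernel_0:
  "is_kernel 0 U P x (\<lambda>_ _. 0)"
  by (simp add: is_kernel_def)

text \<open>If \<open>K\<close> is the kernel of some rows, this is the part of row \<open>i\<close>
  orthogonal to them: the row minus its projection.\<close>

definition residual ::
  "nat \<Rightarrow> (nat \<Rightarrow> nat \<Rightarrow> real) \<Rightarrow> (nat \<Rightarrow> real) \<Rightarrow> (nat \<Rightarrow> nat \<Rightarrow> real) \<Rightarrow> nat \<Rightarrow> nat \<Rightarrow> real" where
  "residual U P x K i u = P i u - (\<Sum>v<U. K u v * x v * P i v)"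

definition sqnorm :: "nat \<Rightarrow> (nat \<Rightarrow> real) \<Rightarrow> (nat \<Rightarrow> real) \<Rightarrow> real" where
  "sqnorm U x w = (\<Sum>u<U. w u * w u * x u)"

text \<open>A Gram--Schmidt step that keeps only the projection kernel. The residual
  \<open>w\<close> is a nontrivial combination of rows, so positive definiteness makes its squared
  norm positive although the weights may have mixed signs.\<close>

lemma is_kernel_Suc:
  fixes P :: "nat \<Rightarrow> nat \<Rightarrow> real"
  assumes K: "is_kernel m U P x K" and m: "m < L" and pd: "pos_def L U P x"
  defines "w \<equiv> residual U P x K m"
  shows "0 < sqnorm U x w"
    and "is_kernel (Suc m) U P x (\<lambda>u v. K u v + w u / sqnorm U x w * w v)"
proof -
  obtain C where C: "\<And>v w. v < U \<Longrightarrow> w < U \<Longrightarrow> K v w = (\<Sum>i<m. C v i * P i w)"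
    using is_kernel_obtain[OF K] by blast
  note rep = is_kernel_reproducing[OF K]
  note sym = is_kernel_sym[OF K]
  \<comment> \<open>These are the coefficients of \<open>w\<close> in the rows of \<open>P\<close>.
    The entry 1 at \<open>m\<close> makes them nontrivial, and the zeros beyond \<open>m\<close>
    extend them to all \<open>L\<close> rows, as \<open>pos_def\<close> requires.\<close>
  define c where "c j = (if j = m then 1 else if j < m then - (\<Sum>v<U. C v j * x v * P m v) else 0)" for j
  have w_sum: "w u = (\<Sum>j<Suc m. c j * P j u)" if u: "u < U" for u
  proof -
    have "(\<Sum>v<U. K u v * x v * P m v) = (\<Sum>v<U. \<Sum>j<m. C v j * P j u * x v * P m v)"
      using u by (intro sum.cong refl) (subst sym, simp_all add: C sum_distrib_right)
    also have "\<dots> = - (\<Sum>j<m. c j * P j u)"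
      by (subst sum.swap) (simp add: c_def sum_distrib_left sum_distrib_right sum_negf mult_ac)
    finally show ?thesis
      by (simp add: w_def residual_def c_def)
  qed
  have "(\<Sum>j<L. c j * P j u) = (\<Sum>j<Suc m. c j * P j u)" for u
    using m by (intro sum.mono_neutral_right) (auto simp: c_def)
  then have "sqnorm U x w = (\<Sum>u<U. x u * (\<Sum>j<L. c j * P j u)\<^sup>2)"
    by (simp add: sqnorm_def w_sum power2_eq_square mult_ac)
  also have "\<dots> > 0"
  proof -
    have "\<exists>i<L. c i \<noteq> 0"
      using m by (auto simp: c_def)
    then show ?thesis
      using pd unfolding pos_def_def by blast
  qed
  finally show pos: "0 < sqnorm U x w" .
  \<comment> \<open>Symmetry of \<open>K\<close> lets the reproducing property act on
    \<open>P j\<close>: row \<open>m\<close> and its projection have the same inner product with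
    \<open>P j\<close>.\<close>
  have orth: "(\<Sum>u<U. w u * x u * P j u) = 0" if j: "j < m" for j
  proof -
    have "(\<Sum>u<U. \<Sum>v<U. K u v * x v * P m v * x u * P j u) =
      (\<Sum>v<U. \<Sum>u<U. K u v * x v * P m v * x u * P j u)"
      by (rule sum.swap)
    also have "\<dots> = (\<Sum>v<U. (\<Sum>u<U. K v u * x u * P j u) * (x v * P m v))"
      unfolding sum_distrib_right by (intro sum.cong refl) (subst sym, simp_all add: mult_ac)
    also have "\<dots> = (\<Sum>v<U. P m v * x v * P j v)"
      by (intro sum.cong refl) (subst rep, simp_all add: j)
    finally show ?thesis
      unfolding w_def residual_def left_diff_distrib sum_subtractf sum_distrib_right
      by (simp only:)
  qed
  \<comment> \<open>When one factor \<open>w\<close> is expanded in the rows, orthogonality removes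
    the terms \<open>j < m\<close>, and \<open>c m = 1\<close>.\<close>
  have norm: "(\<Sum>u<U. w u * x u * P m u) = sqnorm U x w"
  proof -
    have "sqnorm U x w = (\<Sum>u<U. \<Sum>j<Suc m. c j * (w u * x u * P j u))"
      unfolding sqnorm_def
    proof (intro sum.cong refl)
      fix u
      assume "u \<in> {..<U}"
      then have "w u * w u * x u = (\<Sum>j<Suc m. c j * P j u) * (w u * x u)"
        by (metis w_sum lessThan_iff mult.assoc)
      also have "\<dots> = (\<Sum>j<Suc m. c j * (w u * x u * P j u))"
        unfolding sum_distrib_right by (simp only: mult_ac)
      finally show "w u * w u * x u = (\<Sum>j<Suc m. c j * (w u * x u * P j u))" .
    qed
    also have "\<dots> = (\<Sum>j<Suc m. c j * (\<Sum>u<U. w u * x u * P j u))"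
      by (subst sum.swap) (simp add: sum_distrib_left)
    also have "\<dots> = (\<Sum>u<U. w u * x u * P m u)"
      by (simp add: orth c_def)
    finally show ?thesis
      by simp
  qed
  show "is_kernel (Suc m) U P x (\<lambda>u v. K u v + w u / sqnorm U x w * w v)"
    unfolding is_kernel_def
  proof (intro conjI allI impI)
    show "\<exists>C. \<forall>u<U. \<forall>v<U. K u v + w u / sqnorm U x w * w v = (\<Sum>i<Suc m. C u i * P i v)"
    proof (intro exI[of _ "\<lambda>u i. (if i < m then C u i else 0) + w u / sqnorm U x w * c i"] allI impI)
      fix u v
      assume "u < U" "v < U"
      moreover have "(\<Sum>i<Suc m. ((if i < m then C u i else 0) + k * c i) * P i v) =
          (\<Sum>i<m. C u i * P i v) + k * (\<Sum>i<Suc m. c i * P i v)" for k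
        by (simp add: distrib_right distrib_left sum.distrib sum_distrib_left mult.assoc)
      ultimately show "K u v + w u / sqnorm U x w * w v =
          (\<Sum>i<Suc m. ((if i < m then C u i else 0) + w u / sqnorm U x w * c i) * P i v)"
        by (simp only: C w_sum[of v])
    qed
    show "(\<Sum>v<U. (K u v + w u / sqnorm U x w * w v) * x v * P i v) = P i u"
      if u: "u < U" and i: "i < Suc m" for u i
    proof -
      have "(\<Sum>v<U. (K u v + k * w v) * x v * P i v) =
        (\<Sum>v<U. K u v * x v * P i v) + k * (\<Sum>v<U. w v * x v * P i v)" for k
        by (simp add: distrib_right sum.distrib sum_distrib_left mult.assoc)
      note * = this[of "w u / sqnorm U x w"]
      have w_u: "w u = P m u - (\<Sum>v<U. K u v * x v * P m v)"
        by (simp add: w_def residual_def)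
      show ?thesis
      proof (cases "i < m")
        case True
        then show ?thesis
          unfolding * by (simp add: rep u orth)
      next
        case False
        then have "i = m"
          using i by simp
        \<comment> \<open>For the new row the correction amounts to exactly \<open>w u\<close>,
          which is what the old kernel fails to reproduce.\<close>
        moreover have "w u / sqnorm U x w * sqnorm U x w = w u"
          using pos by simp
        ultimately show ?thesis
          unfolding * by (simp only: norm) (simp add: w_u)
      qed
    qed
    show "K u v + w u / sqnorm U x w * w v = K v u + w v / sqnorm U x w * w u" if "u < U" "v < U" for u v
      using sym[OF that] by (simp add: mult_ac)
  qed
qed

section \<open>Polynomials and Lagrange bases\<close>

definition monom_eval :: "(nat \<Rightarrow> real) \<Rightarrow> (nat \<Rightarrow>\<^sub>0 nat) \<Rightarrow> real" where
  "monom_eval t m = (\<Prod>i \<in> Poly_Mapping.keys m. t i ^ Poly_Mapping.lookup m i)"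

text \<open>Over the union of both supports the exponents add factor by factor; padding variables
  contribute \<open>t i ^ 0 = 1\<close>.\<close>

lemma monom_eval_add: "monom_eval t (k + m) = monom_eval t k * monom_eval t m"
proof -
  let ?B = "Poly_Mapping.keys k \<union> Poly_Mapping.keys m"
  have superset: "monom_eval t l = (\<Prod>i\<in>?B. t i ^ Poly_Mapping.lookup l i)"
    if "Poly_Mapping.keys l \<subseteq> ?B" for l
    unfolding monom_eval_def using that by (intro prod.mono_neutral_left) (auto simp: in_keys_iff)
  show ?thesis
    using keys_add[of k m] by (simp add: superset lookup_add power_add prod.distrib)
qed

lemma total_deg_add: "total_deg (k + m) = total_deg k + total_deg m"
proof -
  let ?B = "Poly_Mapping.keys k \<union> Poly_Mapping.keys m"
  have superset: "total_deg l = (\<Sum>i\<in>?B. Poly_Mapping.lookup l i)"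
    if "Poly_Mapping.keys l \<subseteq> ?B" for l
    unfolding total_deg_def using that by (intro sum.mono_neutral_left) (auto simp: in_keys_iff)
  show ?thesis
    using keys_add[of k m] by (simp add: superset lookup_add sum.distrib)
qed

lemma peval_superset:
  assumes "finite A" "Poly_Mapping.keys f \<subseteq> A"
  shows "peval f t = (\<Sum>m\<in>A. Poly_Mapping.lookup f m * monom_eval t m)"
  unfolding peval_def monom_eval_def using assms
  by (intro sum.mono_neutral_left) (auto simp: in_keys_iff)

lemma peval_add: "peval (f + g) t = peval f t + peval g t"
proof -
  let ?A = "Poly_Mapping.keys f \<union> Poly_Mapping.keys g"
  show ?thesis
    using keys_add[of f g]
    by (simp add: peval_superset[of ?A] lookup_add distrib_right sum.distrib)
qed

lemma peval_0 [simp]: "peval 0 t = 0"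
  by (simp add: peval_def)

lemma peval_sum: "peval (\<Sum>i\<in>A. f i) t = (\<Sum>i\<in>A. peval (f i) t)"
  by (induction A rule: infinite_finite_induct) (simp_all add: peval_add)

lemma peval_single: "peval (Poly_Mapping.single m c) t = c * monom_eval t m"
  by (simp add: peval_def monom_eval_def)

lemma sum_single_lookup: "(\<Sum>m\<in>Poly_Mapping.keys f. Poly_Mapping.single m (Poly_Mapping.lookup f m)) = f"
  by (rule poly_mapping_eqI) (auto simp: lookup_sum lookup_single when_def in_keys_iff)

text \<open>Both factors are expanded into monomials, on which evaluation is multiplicative by
  \<open>monom_eval_add\<close>.\<close>

lemma peval_mult: "peval (f * g) t = peval f t * peval g t"
proof -
  have "f * g = (\<Sum>k\<in>Poly_Mapping.keys f. \<Sum>m\<in>Poly_Mapping.keys g.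
      Poly_Mapping.single (k + m) (Poly_Mapping.lookup f k * Poly_Mapping.lookup g m))"
    by (subst (1) sum_single_lookup[of f, symmetric], subst (1) sum_single_lookup[of g, symmetric])
      (simp add: sum_product mult_single)
  then have "peval (f * g) t = (\<Sum>k\<in>Poly_Mapping.keys f. \<Sum>m\<in>Poly_Mapping.keys g.
      Poly_Mapping.lookup f k * monom_eval t k * (Poly_Mapping.lookup g m * monom_eval t m))"
    by (simp add: peval_sum peval_single monom_eval_add mult_ac)
  then show ?thesis
    by (simp add: peval_def sum_product flip: monom_eval_def)
qed

lemma peval_psmult: "peval (psmult c f) t = c * peval f t"
  by (simp add: psmult_def peval_mult peval_single monom_eval_def)

lemma polys_0: "0 \<in> polys n r"
  by (simp add: polys_def)

lemma polys_add: "f \<in> polys n r \<Longrightarrow> g \<in> polys n r \<Longrightarrow> f + g \<in> polys n r"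
  using keys_add[of f g] by (fastforce simp: polys_def)

lemma polys_mult:
  assumes f: "f \<in> polys n r" and g: "g \<in> polys n s"
  shows "f * g \<in> polys n (r + s)"
  unfolding polys_def
proof (intro CollectI ballI)
  fix m
  assume "m \<in> Poly_Mapping.keys (f * g)"
  then obtain a b where m: "m = a + b" "a \<in> Poly_Mapping.keys f" "b \<in> Poly_Mapping.keys g"
    using keys_mult[of f g] by blast
  have "Poly_Mapping.keys m \<subseteq> Poly_Mapping.keys a \<union> Poly_Mapping.keys b"
    unfolding m by (rule keys_add)
  moreover have "Poly_Mapping.keys a \<subseteq> {..<n}" "total_deg a \<le> r"
      "Poly_Mapping.keys b \<subseteq> {..<n}" "total_deg b \<le> s"
    using f g m unfolding polys_def by auto
  ultimately show "Poly_Mapping.keys m \<subseteq> {..<n} \<and> total_deg m \<le> r + s"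
    using m(1) by (auto simp: total_deg_add)
qed

lemma polys_mono: "r \<le> s \<Longrightarrow> polys n r \<subseteq> polys n s"
  by (auto simp: polys_def)

lemma polys_psmult: "f \<in> polys n r \<Longrightarrow> psmult c f \<in> polys n r"
  using polys_mult[of "Poly_Mapping.single 0 c" n 0 f r]
  by (simp add: psmult_def polys_def total_deg_def)

lemma polys_sum: "(\<And>i. i \<in> A \<Longrightarrow> f i \<in> polys n r) \<Longrightarrow> (\<Sum>i\<in>A. f i) \<in> polys n r"
  by (induction A rule: infinite_finite_induct) (simp_all add: polys_0 polys_add)

section \<open>Coordinates in a Lagrange basis are point values\<close>

context
  fixes n r :: nat and ts :: "(nat \<Rightarrow> real) list" and qs :: "mpoly list"
  assumes lagrange: "lagrange_basis n r ts qs"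
begin

lemma lagrange_peval_qs:
  "u < length qs \<Longrightarrow> v < length qs \<Longrightarrow> peval (qs ! u) (ts ! v) = (if v = u then 1 else 0)"
  using lagrange by (simp add: lagrange_basis_def)

lemma lagrange_qs_polys: "u < length qs \<Longrightarrow> qs ! u \<in> polys n r"
  using lagrange by (auto simp: lagrange_basis_def)

text \<open>Equal polynomials at different positions would take both values 0 and 1 at the same
  point.\<close>

lemma lagrange_distinct: "distinct qs"
  unfolding distinct_conv_nth using lagrange_peval_qs by (metis zero_neq_one)

lemma lagrange_eqI:
  assumes "f \<in> polys n r" "g \<in> polys n r"
    and "\<And>u. u < length qs \<Longrightarrow> peval f (ts ! u) = peval g (ts ! u)"
  shows "f = g"
  using lagrange assms unfolding lagrange_basis_def unisolvent_def by (metis in_set_conv_nth)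

lemma peval_lagrange_sum:
  assumes "v < length qs"
  shows "peval (\<Sum>u<length qs. psmult (c u) (qs ! u)) (ts ! v) = c v"
  using assms by (simp add: peval_sum peval_psmult lagrange_peval_qs if_distrib cong: if_cong)

lemma lagrange_expansion:
  assumes "f \<in> polys n r"
  shows "(\<Sum>u<length qs. psmult (peval f (ts ! u)) (qs ! u)) = f"
  using assms
  by (intro lagrange_eqI polys_sum polys_psmult) (simp_all add: peval_lagrange_sum lagrange_qs_polys)

text \<open>Translates between coordinates indexed by basis elements, as in
  \<open>mpoly.representation\<close>, and coordinates indexed by positions in
  \<open>qs\<close>.\<close>

lemma sum_set_qs: "(\<Sum>q\<in>set qs. psmult (c q) q) = (\<Sum>u<length qs. psmult (c (qs ! u)) (qs ! u))"
  using sum.reindex_bij_betw[OF bij_betw_nth[OF lagrange_distinct refl refl], of "\<lambda>q. psmult (c q) q"]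
  by simp

lemma lagrange_independent: "mpoly.independent (set qs)"
proof
  assume "mpoly.dependent (set qs)"
  then obtain c q where c: "q \<in> set qs" "c q \<noteq> 0" "(\<Sum>q\<in>set qs. psmult (c q) q) = 0"
    by (auto simp: mpoly.dependent_finite)
  then obtain v where v: "v < length qs" "q = qs ! v"
    by (auto simp: in_set_conv_nth)
  have "c q = peval (\<Sum>q\<in>set qs. psmult (c q) q) (ts ! v)"
    using v by (simp add: sum_set_qs peval_lagrange_sum)
  then show False
    using c by simp
qed

text \<open>This identifies the input cells with the matrix of values and turns
  \<open>Lambda\<close> into a Gram matrix. Evaluation at \<open>ts ! u\<close> isolates the
  coordinate at \<open>qs ! u\<close>.\<close>

lemma lagrange_representation:
  assumes f: "f \<in> polys n r" and u: "u < length qs"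
  shows "mpoly.representation (set qs) f (qs ! u) = peval f (ts ! u)"
proof -
  have "f \<in> mpoly.span (set qs)"
    by (subst lagrange_expansion[OF f, symmetric])
      (rule mpoly.span_sum, rule mpoly.span_scale, rule mpoly.span_base, simp)
  then have "(\<Sum>q\<in>set qs. psmult (mpoly.representation (set qs) f q) q) = f"
    by (intro mpoly.sum_representation_eq lagrange_independent) auto
  then have "peval f (ts ! u) =
      peval (\<Sum>q\<in>set qs. psmult (mpoly.representation (set qs) f q) q) (ts ! u)"
    by simp
  also have "\<dots> = mpoly.representation (set qs) f (qs ! u)"
    using u by (simp add: sum_set_qs peval_lagrange_sum)
  finally show ?thesis
    by simp
qed

end

section \<open>The operator \<open>Lambda\<close> and positive definiteness on the interior of the
  dual cone\<close>

lemma ordered_basis_nth_polys: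
  assumes "ordered_basis n r bs" "i < length bs"
  shows "bs ! i \<in> polys n r"
  using assms mpoly.span_superset[of "set bs"] by (auto simp: ordered_basis_def)

lemma Lambda_eq_gram:
  assumes ps: "ordered_basis n d ps" and qs: "lagrange_basis n (2 * d) ts qs"
  shows "Lambda ps qs x = gram (length ps) (length qs) (\<lambda>i u. peval (ps ! i) (ts ! u)) x"
proof -
  have "ps ! i * ps ! j \<in> polys n (2 * d)" if "i < length ps" "j < length ps" for i j
    using polys_mult[OF ordered_basis_nth_polys[OF ps that(1)] ordered_basis_nth_polys[OF ps that(2)]]
    by (simp add: mult_2)
  then show ?thesis
    by (auto simp: Lambda_def gram_def Lambda_coeff_def lagrange_representation[OF qs] peval_mult mult.assoc)
qed

text \<open>Lowering all coordinates by \<open>e\<close> is a continuous curve through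
  \<open>x\<close>, so it stays in the open set \<open>T\<close> for small \<open>e\<close>. This
  margin later turns a weak inequality into a strict one.\<close>

lemma interior_of_Euclidean_space_shift:
  assumes "x \<in> Euclidean_space m interior_of S"
  obtains e where "0 < e" "(\<lambda>u. if u < m then x u - e else 0) \<in> S"
proof -
  obtain T where T: "openin (Euclidean_space m) T" "x \<in> T" "T \<subseteq> S"
    using assms by (auto simp: interior_of_def)
  define h where "h e = (\<lambda>u. if u < m then x u - e else 0)" for e
  have "x \<in> topspace (Euclidean_space m)"
    using T openin_subset by blast
  then have h0: "h 0 = x"
    by (auto simp: h_def topspace_Euclidean_space fun_eq_iff not_less)
  have "continuous_map euclideanreal (Euclidean_space m) h"
    unfolding h_def
    by (auto simp: continuous_map_componentwise_Euclidean_space continuous_map_iff_continuous2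
        intro!: continuous_intros)
  then have "open {e. h e \<in> T}"
    using T(1) openin_continuous_map_preimage by fastforce
  then obtain e where e: "0 < e" "ball 0 e \<subseteq> {e. h e \<in> T}"
    using T(2) h0 by (metis mem_Collect_eq open_contains_ball)
  then have "h (e / 2) \<in> T"
    by (auto simp: subset_iff dist_norm)
  then show thesis
    using that[of "e / 2"] e(1) T(3) by (auto simp: h_def)
qed

text \<open>The combination \<open>g\<close> of the basis with coefficients \<open>c\<close> has a
  square in the cone, with Lagrange coordinates \<open>s\<close>. Pairing \<open>s\<close> with the
  shifted point bounds the form at \<open>x\<close> below by \<open>e\<close> times the sum of
  squared values of \<open>g\<close>, which is positive by unisolvence.\<close>

lemma pos_def_interior_dual_cone:
  assumes ps: "ordered_basis n d ps" and qs: "lagrange_basis n (2 * d) ts qs"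
    and x: "x \<in> Euclidean_space (length qs) interior_of dual_cone (length qs) (sos_cone n d qs)"
  shows "pos_def (length ps) (length qs) (\<lambda>i u. peval (ps ! i) (ts ! u)) x"
  unfolding pos_def_def
proof (intro allI impI)
  fix c :: "nat \<Rightarrow> real"
  assume c: "\<exists>i<length ps. c i \<noteq> 0"
  let ?U = "length qs"
  define g where "g = (\<Sum>i<length ps. psmult (c i) (ps ! i))"
  have g_eval: "peval g t = (\<Sum>i<length ps. c i * peval (ps ! i) t)" for t
    by (simp add: g_def peval_sum peval_psmult)
  have g_polys: "g \<in> polys n d"
    unfolding g_def by (intro polys_sum polys_psmult) (simp add: ordered_basis_nth_polys[OF ps])
  have "g \<noteq> 0"
  proof
    assume "g = 0"
    have dist: "distinct ps" and ind: "mpoly.independent (set ps)"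
      using ps by (auto simp: ordered_basis_def)
    \<comment> \<open>Independence speaks of coefficients attached to elements of
      \<open>set ps\<close>, so \<open>c\<close> is transported along the positions in the
      list.\<close>
    define idx where "idx p = (THE i. i < length ps \<and> ps ! i = p)" for p
    have idx: "idx (ps ! i) = i" if "i < length ps" for i
      unfolding idx_def using that dist by (auto simp: nth_eq_iff_index_eq)
    have "(\<Sum>p\<in>set ps. psmult (c (idx p)) p) = (\<Sum>i<length ps. psmult (c (idx (ps ! i))) (ps ! i))"
      using sum.reindex_bij_betw[OF bij_betw_nth[OF dist refl refl], of "\<lambda>p. psmult (c (idx p)) p"]
      by simp
    also have "\<dots> = 0"
      using \<open>g = 0\<close> by (simp add: g_def idx)
    finally have "c (idx p) = 0" if "p \<in> set ps" for p
      using mpoly.independentD[OF ind _ order_refl _ that] by auto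
    then show False
      using c idx by (metis nth_mem)
  qed
  then obtain v where v: "v < ?U" "peval g (ts ! v) \<noteq> 0"
    using lagrange_eqI[OF qs, of g 0] g_polys polys_mono[of d "2 * d" n] polys_0 by auto
  define s where "s u = (if u < ?U then (peval g (ts ! u))\<^sup>2 else 0)" for u
  have "(\<Sum>u<?U. psmult (s u) (qs ! u)) = g * g"
    using lagrange_expansion[OF qs, of "g * g"] polys_mult[OF g_polys g_polys]
    by (simp add: s_def peval_mult power2_eq_square mult_2)
  then have s: "s \<in> sos_cone n d qs"
    unfolding sos_cone_def topspace_Euclidean_space using g_polys
    by (auto simp: s_def power2_eq_square intro!: exI[of _ "[g]"])
  obtain e where e: "0 < e"
    "(\<lambda>u. if u < ?U then x u - e else 0) \<in> dual_cone ?U (sos_cone n d qs)"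
    using interior_of_Euclidean_space_shift[OF x] .
  then have "0 \<le> (\<Sum>u<?U. s u * (x u - e))"
    using s by (auto simp: dual_cone_def)
  also have "\<dots> = (\<Sum>u<?U. x u * (peval g (ts ! u))\<^sup>2) - e * (\<Sum>u<?U. (peval g (ts ! u))\<^sup>2)"
    by (simp add: s_def left_diff_distrib right_diff_distrib sum_subtractf sum_distrib_left mult_ac)
  finally have "e * (\<Sum>u<?U. (peval g (ts ! u))\<^sup>2) \<le> (\<Sum>u<?U. x u * (peval g (ts ! u))\<^sup>2)"
    by simp
  moreover have "0 < (\<Sum>u<?U. (peval g (ts ! u))\<^sup>2)"
    using v by (intro sum_pos2[of _ v]) auto
  ultimately show "0 < (\<Sum>u<?U. x u * (\<Sum>i<length ps. c i * peval (ps ! i) (ts ! u))\<^sup>2)"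
    unfolding g_eval using e(1) by (smt (verit) mult_pos_pos)
qed

section \<open>The program\<close>

lemma exec_Loop:
  assumes init: "I 0 (s\<lparr>steps := steps s + 1\<rparr>)"
    and step: "\<And>k s'. k < index s b \<Longrightarrow> I k s' \<Longrightarrow> I (Suc k) (exec c (set_index r k s'))"
  shows "I (index s b) (exec (Loop r b c) s)"
proof -
  have "I n (fold (\<lambda>k s'. exec c (set_index r k s')) [0..<n] (s\<lparr>steps := steps s + 1\<rparr>))"
    if "n \<le> index s b" for n
    using that init by (induction n) (simp_all add: step)
  then show ?thesis
    by simp
qed

lemma nat_digit_less:
  fixes i u L U :: nat
  assumes "i < L" "u < U"
  shows "i * U + u < L * U"
proof -
  have "i * U + u < (i + 1) * U"
    using assms by simp
  also have "\<dots> \<le> L * U"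
    using assms by (intro mult_le_mono1) simp
  finally show ?thesis .
qed

text \<open>Uniqueness of division with remainder by \<open>U\<close>; it makes row-major addresses
  injective.\<close>

lemma nat_digit_eq_iff:
  fixes i j u v U :: nat
  assumes "u < U" "v < U"
  shows "i * U + u = j * U + v \<longleftrightarrow> i = j \<and> u = v"
proof
  assume eq: "i * U + u = j * U + v"
  have "(i * U + u) div U = (j * U + v) div U" "(i * U + u) mod U = (j * U + v) mod U"
    by (simp_all only: eq)
  then show "i = j \<and> u = v"
    using assms by simp
qed simp

text \<open>
  \<open>LP\<close> and \<open>LX\<close> are the input cells. \<open>LG\<close> are the cells of the gradient, which hold the current
  residual row in the meantime; \<open>LH\<close> are the cells of the Hessian, which hold the current kernel.
  \<open>LN\<close> holds the squared norm of the residual row; \<open>LA\<close> and \<open>LT\<close> are scratch cells.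
\<close>

datatype location = LP nat nat | LX nat | LG nat | LH nat nat | LN | LA | LT

notation Seq (infixr ";;" 60)

text \<open>
  Index registers: \<open>rX\<close>, \<open>rG\<close>, \<open>rH\<close> hold the base addresses of \<open>x\<close>, gradient and Hessian; \<open>rN\<close>, \<open>rA\<close>, \<open>rT\<close>
  hold the addresses of the single cells; \<open>ri\<close>, \<open>ru\<close>, \<open>rv\<close> are loop counters, and \<open>aH\<close>, \<open>aX\<close>, \<open>aP\<close>, \<open>aG\<close>
  hold computed addresses.
\<close>

abbreviation (input) "rL \<equiv> 0 :: nat"
abbreviation (input) "rU \<equiv> 1 :: nat"
abbreviation (input) "rX \<equiv> 2 :: nat"
abbreviation (input) "rG \<equiv> 3 :: nat"
abbreviation (input) "rH \<equiv> 4 :: nat"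
abbreviation (input) "rUU \<equiv> 5 :: nat"
abbreviation (input) "rN \<equiv> 6 :: nat"
abbreviation (input) "rA \<equiv> 7 :: nat"
abbreviation (input) "rT \<equiv> 8 :: nat"
abbreviation (input) "r1 \<equiv> 9 :: nat"
abbreviation (input) "ri \<equiv> 10 :: nat"
abbreviation (input) "ru \<equiv> 11 :: nat"
abbreviation (input) "rv \<equiv> 12 :: nat"
abbreviation (input) "aH \<equiv> 13 :: nat"
abbreviation (input) "aX \<equiv> 14 :: nat"
abbreviation (input) "aP \<equiv> 15 :: nat"
abbreviation (input) "aG \<equiv> 16 :: nat"

section \<open>Program text: accumulating the kernel and reading off the derivatives\<close>

definition setup_code :: program where
  "setup_code =
     Index_Mult rX rL rU ;; Index_Add rG rX rU ;; Index_Add rH rG rU ;; Index_Mult rUU rU rU ;;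
     Index_Add rN rH rUU ;; Index_Const r1 1 ;; Index_Add rA rN r1 ;; Index_Add rT rA r1"

definition clear_body :: program where
  "clear_body = Index_Mult aH ru rU ;; Index_Add aH aH rv ;; Index_Add aH rH aH ;; Real_Const aH 0"

definition dot_address :: program where
  "dot_address =
     Index_Mult aH ru rU ;; Index_Add aH aH rv ;; Index_Add aH rH aH ;;
     Index_Add aX rX rv ;; Index_Mult aP ri rU ;; Index_Add aP aP rv"

definition dot_arith :: program where
  "dot_arith =
     Real_Op Multiplication rT aH aX ;; Real_Op Multiplication rT rT aP ;;
     Real_Op Addition rA rA rT"

definition residual_address :: program where
  "residual_address =
     Index_Mult aP ri rU ;; Index_Add aP aP ru ;; Index_Add aG rG ru ;; Index_Add aX rX ru"

definition residual_arith :: program where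
  "residual_arith =
     Real_Op Subtraction aG aP rA ;; Real_Op Multiplication rT aG aG ;;
     Real_Op Multiplication rT rT aX ;; Real_Op Addition rN rN rT"

definition residual_body :: program where
  "residual_body = Real_Const rA 0 ;; Loop rv rU (dot_address ;; dot_arith) ;; residual_address ;; residual_arith"

definition update_body :: program where
  "update_body =
     Index_Mult aH ru rU ;; Index_Add aH aH rv ;; Index_Add aH rH aH ;; Index_Add aG rG rv ;;
     Real_Op Multiplication rT rA aG ;; Real_Op Addition aH aH rT"

text \<open>The only division of the program, performed once per kernel row and before its inner
  loop.\<close>

definition quotient_code :: program where
  "quotient_code = Index_Add aG rG ru ;; Real_Op Division rA aG rN"

text \<open>Two separate passes: updating any kernel row uses the whole residual row and its final
  squared norm.\<close>

definition stage_body :: program where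
  "stage_body =
     Real_Const rN 0 ;; Loop ru rU residual_body ;;
     Loop ru rU (quotient_code ;; Loop rv rU update_body)"

definition gradient_body :: program where
  "gradient_body =
     Index_Mult aH ru rU ;; Index_Add aH aH ru ;; Index_Add aH rH aH ;; Index_Add aG rG ru ;;
     Real_Const rT 0 ;; Real_Op Subtraction aG rT aH"

definition square_body :: program where
  "square_body =
     Index_Mult aH ru rU ;; Index_Add aH aH rv ;; Index_Add aH rH aH ;;
     Real_Op Multiplication aH aH aH"

text \<open>The gradient is read off the diagonal of the kernel before the kernel is squared in
  place.\<close>

definition derivatives_program :: program where
  "derivatives_program =
     setup_code ;; Loop ru rU (Loop rv rU clear_body) ;; Loop ri rL stage_body ;;
     Loop ru rU gradient_body ;; Loop ru rU (Loop rv rU square_body)"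

section \<open>Memory layout and frame conditions\<close>

context
  fixes L U :: nat
begin

definition "XB = L * U"
definition "GB = XB + U"
definition "HB = GB + U"

fun address :: "location \<Rightarrow> nat" where
  "address (LP i u) = i * U + u"
| "address (LX u) = XB + u"
| "address (LG u) = GB + u"
| "address (LH u v) = HB + (u * U + v)"
| "address LN = HB + U * U"
| "address LA = HB + U * U + 1"
| "address LT = HB + U * U + 2"

text \<open>Only for indices in range are the blocks of memory disjoint and \<open>address\<close>
  injective.\<close>

fun valid :: "location \<Rightarrow> bool" where
  "valid (LP i u) \<longleftrightarrow> i < L \<and> u < U"
| "valid (LX u) \<longleftrightarrow> u < U"
| "valid (LG u) \<longleftrightarrow> u < U"
| "valid (LH u v) \<longleftrightarrow> u < U \<and> v < U"
| "valid LN \<longleftrightarrow> True"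
| "valid LA \<longleftrightarrow> True"
| "valid LT \<longleftrightarrow> True"

text \<open>Isolates the two nonlinear bounds, so that comparing addresses of different blocks
  becomes linear arithmetic.\<close>

lemma valid_digit_less:
  "valid l \<Longrightarrow>
    (case l of LP i u \<Rightarrow> i * U + u < XB | LH u v \<Rightarrow> u * U + v < U * U | _ \<Rightarrow> True)"
  by (cases l) (auto simp: XB_def intro: nat_digit_less)

lemma address_eq_iff [simp]: "valid l \<Longrightarrow> valid l' \<Longrightarrow> address l = address l' \<longleftrightarrow> l = l'"
  using valid_digit_less[of l] valid_digit_less[of l']
  by (cases l; cases l') (auto simp: GB_def HB_def nat_digit_eq_iff)

lemma address_less [simp]: "valid l \<Longrightarrow> address l < HB + U * U + 3"
  using valid_digit_less[of l] by (cases l) (auto simp: GB_def HB_def)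

definition content :: "machine_state \<Rightarrow> location \<Rightarrow> real" where
  "content s l = memory s (address l)"

definition consistent :: "machine_state \<Rightarrow> bool" where
  "consistent s \<longleftrightarrow>
     index s rL = L \<and> index s rU = U \<and> index s rX = XB \<and> index s rG = GB \<and> index s rH = HB \<and>
     index s rUU = U * U \<and> index s rN = address LN \<and> index s rA = address LA \<and> index s rT = address LT \<and>
     cells s \<subseteq> {..<HB + U * U + 3} \<and> \<not> faulted s"

text \<open>A frame specification: \<open>R\<close> are registers preserved for enclosing loops,
  \<open>W\<close> the locations that may change. The step count is exact because the control flow
  does not depend on real data.\<close>

definition effect ::
  "nat set \<Rightarrow> nat \<Rightarrow> location set \<Rightarrow> machine_state \<Rightarrow> machine_state \<Rightarrow> bool" where
  "effect R n W s s' \<longleftrightarrow>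
     consistent s' \<and> (\<forall>r\<in>R. index s' r = index s r) \<and> steps s' = steps s + n \<and>
     (\<forall>l. valid l \<longrightarrow> l \<notin> W \<longrightarrow> content s' l = content s l)"

lemma content_set_index [simp]: "content (set_index r k s) l = content s l"
  by (simp add: content_def set_index_def)

lemma content_steps [simp]: "content (s\<lparr>steps := n\<rparr>) l = content s l"
  by (simp add: content_def)

lemma consistent_steps [simp]: "consistent (s\<lparr>steps := n\<rparr>) = consistent s"
  by (simp add: consistent_def)

lemma consistent_set_index [simp]: "9 < r \<Longrightarrow> consistent (set_index r k s) = consistent s"
  by (simp add: consistent_def set_index_def)

lemma steps_set_index [simp]: "steps (set_index r k s) = steps s + 1"
  by (simp add: set_index_def)

lemma index_set_index [simp]: "index (set_index r k s) r' = (if r' = r then k else index s r')"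
  by (simp add: set_index_def)

lemma effect_consistent: "effect R n W s s' \<Longrightarrow> consistent s'"
  by (simp add: effect_def)

lemma effect_content: "effect R n W s s' \<Longrightarrow> valid l \<Longrightarrow> l \<notin> W \<Longrightarrow> content s' l = content s l"
  by (simp add: effect_def)

lemma effect_mono:
  "effect R n W s s' \<Longrightarrow> R' \<subseteq> R \<Longrightarrow> W \<subseteq> W' \<Longrightarrow> effect R' n W' s s'"
  by (auto simp: effect_def)

lemma effect_trans:
  "effect R m W s s' \<Longrightarrow> effect R n W s' s'' \<Longrightarrow> effect R (m + n) W s s''"
  by (auto simp: effect_def)

text \<open>Entering costs one step, and each iteration one more than its body for setting the
  counter. By \<open>I_cong\<close> the invariant depends on memory contents alone, so it survives
  these administrative steps.\<close>

lemma effect_Loop: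
  assumes consistent: "consistent s" and r: "9 < r" "r \<notin> R" and b: "index s b = N"
    and init: "I 0 s"
    and I_cong: "\<And>k s s'. I k s \<Longrightarrow> content s' = content s \<Longrightarrow> I k s'"
    and step: "\<And>k s'. k < N \<Longrightarrow> consistent s' \<Longrightarrow> index s' r = k \<Longrightarrow> (\<And>q. q \<in> R \<Longrightarrow> index s' q = index s q) \<Longrightarrow>
      (\<And>l. valid l \<Longrightarrow> l \<notin> W \<Longrightarrow> content s' l = content s l) \<Longrightarrow> I k s' \<Longrightarrow>
      effect R n W s' (exec c s') \<and> I (Suc k) (exec c s')"
  shows "effect R (1 + N * (n + 1)) W s (exec (Loop r b c) s) \<and> I N (exec (Loop r b c) s)"
proof -
  let ?J = "\<lambda>k s'. effect R (1 + k * (n + 1)) W s s' \<and> I k s'"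
  have "?J (index s b) (exec (Loop r b c) s)"
  proof (rule exec_Loop[where I = ?J])
    show "?J 0 (s\<lparr>steps := steps s + 1\<rparr>)"
      using consistent I_cong[OF init, of "s\<lparr>steps := steps s + 1\<rparr>"]
      by (auto simp: effect_def fun_eq_iff)
  next
    fix k s'
    assume k: "k < index s b" and J: "?J k s'"
    have "effect R n W (set_index r k s') (exec c (set_index r k s')) \<and>
        I (Suc k) (exec c (set_index r k s'))"
    proof (rule step)
      show "I k (set_index r k s')"
        using J I_cong[of k s' "set_index r k s'"] by (auto simp: fun_eq_iff)
      show "index (set_index r k s') q = index s q" if "q \<in> R" for q
        using J r that by (auto simp: effect_def)
    qed (use J k r b in \<open>auto simp: effect_def\<close>)
    then show "?J (Suc k) (exec c (set_index r k s'))"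
      using J r by (auto simp: effect_def)
  qed
  then show ?thesis
    by (simp add: b)
qed

text \<open>The folding rules turn computed numbers back into addresses of locations, so that
  \<open>address_eq_iff\<close> decides which cells coincide. A kernel offset first appears as an
  \<open>LP\<close> address and is then absorbed by \<open>fold_LH\<close>.\<close>

lemma fold_LP: "i * U + u = address (LP i u)"
  by simp

lemma fold_LX: "XB + u = address (LX u)"
  by simp

lemma fold_LG: "GB + u = address (LG u)"
  by simp

lemma fold_LH: "HB + address (LP u v) = address (LH u v)"
  by simp

lemmas body_simps = effect_def consistent_def content_def set_index_def fold_LP fold_LX fold_LG fold_LH

section \<open>Effects of the straight-line code blocks\<close>

context
  fixes s :: machine_state and i u v :: nat
  assumes s: "consistent s" and u: "index s ru = u" "u < U"
begin

lemma clear_body: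
  assumes "index s rv = v" "v < U"
  shows "effect {ri, ru} 4 {LH u v} s (exec clear_body s) \<and> content (exec clear_body s) (LH u v) = 0"
  using s u assms by (simp add: clear_body_def body_simps del: address.simps)

lemma dot_address:
  assumes "index s rv = v" "index s ri = i"
  shows "effect {ri, ru} 6 {} s (exec dot_address s) \<and>
    index (exec dot_address s) aH = address (LH u v) \<and> index (exec dot_address s) aX = address (LX v) \<and>
    index (exec dot_address s) aP = address (LP i v)"
  using s u assms by (simp add: dot_address_def body_simps del: address.simps)

lemma dot_arith:
  assumes "index s aH = address (LH u v)" "index s aX = address (LX v)" "index s aP = address (LP i v)" "i < L" "v < U"
  shows "effect {ri, ru} 3 {LA, LT} s (exec dot_arith s) \<and>
    content (exec dot_arith s) LA = content s LA + content s (LH u v) * content s (LX v) * content s (LP i v)"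
  using s u assms by (simp add: dot_arith_def body_simps del: address.simps)

lemma residual_address:
  assumes "index s ri = i"
  shows "effect {ri, ru} 4 {} s (exec residual_address s) \<and>
    index (exec residual_address s) aG = address (LG u) \<and> index (exec residual_address s) aX = address (LX u) \<and>
    index (exec residual_address s) aP = address (LP i u)"
  using s u assms by (simp add: residual_address_def body_simps del: address.simps)

lemma residual_arith:
  assumes "index s aG = address (LG u)" "index s aX = address (LX u)" "index s aP = address (LP i u)" "i < L"
  shows "effect {ri, ru} 4 {LG u, LT, LN} s (exec residual_arith s) \<and>
    content (exec residual_arith s) (LG u) = content s (LP i u) - content s LA \<and>
    content (exec residual_arith s) LN = content s LN +
      (content s (LP i u) - content s LA) * (content s (LP i u) - content s LA) * content s (LX u)"
  using s u assms by (simp add: residual_arith_def body_simps del: address.simps)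

lemma update_body:
  assumes "index s rv = v" "v < U"
  shows "effect {ri, ru} 6 {LH u v, LT} s (exec update_body s) \<and>
    content (exec update_body s) (LH u v) = content s (LH u v) + content s LA * content s (LG v)"
  using s u assms by (simp add: update_body_def body_simps del: address.simps)

lemma quotient_code:
  assumes "content s LN \<noteq> 0"
  shows "effect {ri, ru} 2 {LA} s (exec quotient_code s) \<and>
    content (exec quotient_code s) LA = content s (LG u) / content s LN"
  using s u assms by (simp add: quotient_code_def body_simps del: address.simps)

lemma gradient_body:
  shows "effect {ri, ru} 6 {LG u, LT} s (exec gradient_body s) \<and>
    content (exec gradient_body s) (LG u) = - content s (LH u u)"
  using s u by (simp add: gradient_body_def body_simps del: address.simps)

lemma square_body:
  assumes "index s rv = v" "v < U"
  shows "effect {ri, ru} 4 {LH u v} s (exec square_body s) \<and>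
    content (exec square_body s) (LH u v) = (content s (LH u v))\<^sup>2"
  using s u assms by (simp add: square_body_def body_simps power2_eq_square del: address.simps)

end

section \<open>Loops over kernel entries and the residual inner product\<close>

lemma not_in_range [simp]:
  "LP i u \<notin> range LG" "LX u \<notin> range LG" "LH u v \<notin> range LG" "LG v \<notin> range (LH u)" "LA \<notin> range (LH u)"
  by auto

definition matrix_cells :: "location set" where
  "matrix_cells = {LH u v | u v. True}"

text \<open>Each entry is transformed exactly once, so entries before the counter are new and the
  others old. \<open>LA\<close> lies outside the write set, which lets the body rely on a quotient
  stored there.\<close>

lemma row_loop:
  assumes consistent: "consistent s" and u: "index s ru = u"
    and body: "\<And>s' v. v < U \<Longrightarrow> consistent s' \<Longrightarrow> index s' ru = u \<Longrightarrow> index s' rv = v \<Longrightarrow>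
      (\<And>l. valid l \<Longrightarrow> l \<notin> range (LH u) \<union> {LT} \<Longrightarrow> content s' l = content s l) \<Longrightarrow>
      effect {ri, ru} n {LH u v, LT} s' (exec c s') \<and>
      content (exec c s') (LH u v) = \<phi> v (content s' (LH u v))"
    and u_less: "u < U"
  shows "effect {ri, ru} (1 + U * (n + 1)) (range (LH u) \<union> {LT}) s (exec (Loop rv rU c) s) \<and>
    (\<forall>v<U. content (exec (Loop rv rU c) s) (LH u v) = \<phi> v (content s (LH u v)))"
proof -
  let ?I = "\<lambda>k s'. \<forall>v<U. content s' (LH u v) = (if v < k then \<phi> v (content s (LH u v)) else content s (LH u v))"
  have "effect {ri, ru} (1 + U * (n + 1)) (range (LH u) \<union> {LT}) s (exec (Loop rv rU c) s) \<and>
      ?I U (exec (Loop rv rU c) s)"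
  proof (rule effect_Loop[where I = ?I])
    fix k s'
    assume k: "k < U" and s': "consistent s'" "index s' rv = k" "\<And>q. q \<in> {ri, ru} \<Longrightarrow> index s' q = index s q"
      "\<And>l. valid l \<Longrightarrow> l \<notin> range (LH u) \<union> {LT} \<Longrightarrow> content s' l = content s l" "?I k s'"
    have "index s' ru = u"
      using s'(3)[of ru] u by simp
    then have b: "effect {ri, ru} n {LH u k, LT} s' (exec c s') \<and>
        content (exec c s') (LH u k) = \<phi> k (content s' (LH u k))"
      using body k s' by blast
    have "content (exec c s') (LH u v) = content s' (LH u v)" if "v < U" "v \<noteq> k" for v
      using b that u_less by (auto intro!: effect_content)
    then have "?I (Suc k) (exec c s')"
      using b s'(5) by (auto simp: less_Suc_eq)
    moreover have "effect {ri, ru} n (range (LH u) \<union> {LT}) s' (exec c s')"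
      using b by (auto elim: effect_mono)
    ultimately show "effect {ri, ru} n (range (LH u) \<union> {LT}) s' (exec c s') \<and> ?I (Suc k) (exec c s')"
      by blast
  qed (use consistent in \<open>auto simp: consistent_def\<close>)
  then show ?thesis
    by auto
qed

text \<open>The row-level analogue of \<open>row_loop\<close>; here \<open>LA\<close> may change, as
  each row can compute its own quotient.\<close>

lemma matrix_loop:
  assumes consistent: "consistent s"
    and row: "\<And>s' u. u < U \<Longrightarrow> consistent s' \<Longrightarrow> index s' ru = u \<Longrightarrow>
      (\<And>l. valid l \<Longrightarrow> l \<notin> matrix_cells \<union> {LA, LT} \<Longrightarrow> content s' l = content s l) \<Longrightarrow>
      effect {ri, ru} n (range (LH u) \<union> {LA, LT}) s' (exec c s') \<and>
      (\<forall>v<U. content (exec c s') (LH u v) = \<phi> u v (content s' (LH u v)))"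
  shows "effect {ri} (1 + U * (n + 1)) (matrix_cells \<union> {LA, LT}) s (exec (Loop ru rU c) s) \<and>
    (\<forall>u<U. \<forall>v<U. content (exec (Loop ru rU c) s) (LH u v) = \<phi> u v (content s (LH u v)))"
proof -
  let ?I = "\<lambda>k s'. \<forall>u<U. \<forall>v<U.
    content s' (LH u v) = (if u < k then \<phi> u v (content s (LH u v)) else content s (LH u v))"
  have "effect {ri} (1 + U * (n + 1)) (matrix_cells \<union> {LA, LT}) s (exec (Loop ru rU c) s) \<and>
      ?I U (exec (Loop ru rU c) s)"
  proof (rule effect_Loop[where I = ?I])
    fix k s'
    assume k: "k < U" and s': "consistent s'" "index s' ru = k" "\<And>q. q \<in> {ri} \<Longrightarrow> index s' q = index s q"
      "\<And>l. valid l \<Longrightarrow> l \<notin> matrix_cells \<union> {LA, LT} \<Longrightarrow> content s' l = content s l" "?I k s'"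
    have b: "effect {ri, ru} n (range (LH k) \<union> {LA, LT}) s' (exec c s') \<and>
        (\<forall>v<U. content (exec c s') (LH k v) = \<phi> k v (content s' (LH k v)))"
      using row k s' by blast
    have "content (exec c s') (LH u v) = content s' (LH u v)" if "u < U" "v < U" "u \<noteq> k" for u v
      using b that by (auto intro!: effect_content)
    then have "?I (Suc k) (exec c s')"
      using b s'(5) by (auto simp: less_Suc_eq)
    moreover have "effect {ri} n (matrix_cells \<union> {LA, LT}) s' (exec c s')"
      using b by (auto elim!: effect_mono simp: matrix_cells_def)
    ultimately show "effect {ri} n (matrix_cells \<union> {LA, LT}) s' (exec c s') \<and> ?I (Suc k) (exec c s')"
      by blast
  qed (use consistent in \<open>auto simp: consistent_def\<close>)
  then show ?thesis
    by auto
qed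

lemma entrywise_loop:
  assumes consistent: "consistent s"
    and body: "\<And>s' u v. consistent s' \<Longrightarrow> index s' ru = u \<Longrightarrow> u < U \<Longrightarrow> index s' rv = v \<Longrightarrow> v < U \<Longrightarrow>
      effect {ri, ru} n {LH u v} s' (exec c s') \<and> content (exec c s') (LH u v) = \<phi> (content s' (LH u v))"
  shows "effect {ri} (1 + U * (1 + U * (n + 1) + 1)) (matrix_cells \<union> {LA, LT}) s
      (exec (Loop ru rU (Loop rv rU c)) s) \<and>
    (\<forall>u<U. \<forall>v<U. content (exec (Loop ru rU (Loop rv rU c)) s) (LH u v) = \<phi> (content s (LH u v)))"
proof (rule matrix_loop[OF consistent])
  fix s' u
  assume u: "u < U" and s': "consistent s'" "index s' ru = u"
  have "effect {ri, ru} (1 + U * (n + 1)) (range (LH u) \<union> {LT}) s' (exec (Loop rv rU c) s') \<and>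
      (\<forall>v<U. content (exec (Loop rv rU c) s') (LH u v) = \<phi> (content s' (LH u v)))"
  proof (rule row_loop[OF s' _ u])
    fix t v
    assume "v < U" "consistent t" "index t ru = u" "index t rv = v"
    then have "effect {ri, ru} n {LH u v} t (exec c t) \<and> content (exec c t) (LH u v) = \<phi> (content t (LH u v))"
      using u by (intro body)
    then show "effect {ri, ru} n {LH u v, LT} t (exec c t) \<and>
        content (exec c t) (LH u v) = \<phi> (content t (LH u v))"
      using effect_mono[OF _ order_refl, of "{ri, ru}" n "{LH u v}" t "exec c t" "{LH u v, LT}"] by blast
  qed
  then show "effect {ri, ru} (1 + U * (n + 1)) (range (LH u) \<union> {LA, LT}) s' (exec (Loop rv rU c) s') \<and>
      (\<forall>v<U. content (exec (Loop rv rU c) s') (LH u v) = \<phi> (content s' (LH u v)))"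
    by (auto elim: effect_mono)
qed

text \<open>The factor 10 consists of six address computations, three real operations and the
  setting of the counter.\<close>

lemma dot_loop:
  assumes consistent: "consistent s" and u: "index s ru = u" "u < U" and i: "index s ri = i" "i < L"
  shows "effect {ri, ru} (1 + U * 10) {LA, LT} s (exec (Loop rv rU (dot_address ;; dot_arith)) s) \<and>
    content (exec (Loop rv rU (dot_address ;; dot_arith)) s) LA =
      content s LA + (\<Sum>v<U. content s (LH u v) * content s (LX v) * content s (LP i v))"
proof -
  let ?c = "dot_address ;; dot_arith"
  let ?I = "\<lambda>k s'. content s' LA = content s LA + (\<Sum>v<k. content s (LH u v) * content s (LX v) * content s (LP i v))"
  have "effect {ri, ru} (1 + U * (9 + 1)) {LA, LT} s (exec (Loop rv rU ?c) s) \<and>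
      ?I U (exec (Loop rv rU ?c) s)"
  proof (rule effect_Loop[where I = ?I])
    fix k s'
    assume k: "k < U" and s': "consistent s'" "index s' rv = k" "\<And>q. q \<in> {ri, ru} \<Longrightarrow> index s' q = index s q"
      "\<And>l. valid l \<Longrightarrow> l \<notin> {LA, LT} \<Longrightarrow> content s' l = content s l" "?I k s'"
    have regs: "index s' ru = u" "index s' ri = i"
      using s'(3) u i by auto
    define t where "t = exec dot_address s'"
    have t: "effect {ri, ru} 6 {} s' t" "index t aH = address (LH u k)" "index t aX = address (LX k)"
        "index t aP = address (LP i k)"
      using dot_address[OF s'(1) regs(1) u(2) s'(2) regs(2)] by (auto simp: t_def)
    have t': "consistent t" "index t ru = u"
      using t(1) regs by (auto simp: effect_def)
    have content_t: "content t l = content s' l" if "valid l" for l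
      using t(1) that by (auto simp: effect_def)
    have a: "effect {ri, ru} 3 {LA, LT} t (exec dot_arith t)"
        "content (exec dot_arith t) LA = content t LA + content t (LH u k) * content t (LX k) * content t (LP i k)"
      using dot_arith[OF t'(1,2) u(2) t(2-4) i(2) k] by auto
    have "effect {ri, ru} 9 {LA, LT} s' (exec dot_arith t)"
      using effect_trans[OF effect_mono[OF t(1) order_refl] a(1)] by simp
    moreover have "?I (Suc k) (exec dot_arith t)"
      using a(2) s'(4,5) k u i by (simp add: content_t)
    ultimately show "effect {ri, ru} 9 {LA, LT} s' (exec ?c s') \<and> ?I (Suc k) (exec ?c s')"
      by (simp add: t_def)
  qed (use consistent in \<open>auto simp: consistent_def\<close>)
  then show ?thesis
    by simp
qed

lemma zero_A:
  assumes "consistent s"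
  shows "effect {ri, ru} 1 {LA} s (exec (Real_Const rA 0) s) \<and> content (exec (Real_Const rA 0) s) LA = 0"
  using assms by (simp add: body_simps del: address.simps)

lemma zero_N:
  assumes "consistent s"
  shows "effect {ri, ru} 1 {LN} s (exec (Real_Const rN 0) s) \<and> content (exec (Real_Const rN 0) s) LN = 0"
  using assms by (simp add: body_simps del: address.simps)

lemma residual_body:
  assumes consistent: "consistent s" and u: "index s ru = u" "u < U" and i: "index s ri = i" "i < L"
  defines "w \<equiv> content s (LP i u) - (\<Sum>v<U. content s (LH u v) * content s (LX v) * content s (LP i v))"
  shows "effect {ri, ru} (10 + U * 10) {LG u, LA, LT, LN} s (exec residual_body s) \<and>
    content (exec residual_body s) (LG u) = w \<and>
    content (exec residual_body s) LN = content s LN + w * w * content s (LX u)"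
proof -
  let ?W = "{LG u, LA, LT, LN}"
  define s1 where "s1 = exec (Real_Const rA 0) s"
  define s2 where "s2 = exec (Loop rv rU (dot_address ;; dot_arith)) s1"
  define s3 where "s3 = exec residual_address s2"
  define s4 where "s4 = exec residual_arith s3"
  have s1: "effect {ri, ru} 1 {LA} s s1" "content s1 LA = 0"
    using zero_A[OF consistent] by (auto simp: s1_def)
  have r1: "consistent s1" "index s1 ru = u" "index s1 ri = i"
    using s1(1) u i by (auto simp: effect_def)
  have s2: "effect {ri, ru} (1 + U * 10) {LA, LT} s1 s2"
    "content s2 LA = (\<Sum>v<U. content s1 (LH u v) * content s1 (LX v) * content s1 (LP i v))"
    using dot_loop[OF r1(1,2) u(2) r1(3) i(2)] s1(2) by (auto simp: s2_def)
  have r2: "consistent s2" "index s2 ru = u" "index s2 ri = i"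
    using s2(1) r1 by (auto simp: effect_def)
  have s3: "effect {ri, ru} 4 {} s2 s3" "index s3 aG = address (LG u)" "index s3 aX = address (LX u)"
      "index s3 aP = address (LP i u)"
    using residual_address[OF r2(1,2) u(2) r2(3)] by (auto simp: s3_def)
  have r3: "consistent s3" "index s3 ru = u"
    using s3(1) r2 by (auto simp: effect_def)
  have s4: "effect {ri, ru} 4 {LG u, LT, LN} s3 s4"
      "content s4 (LG u) = content s3 (LP i u) - content s3 LA"
      "content s4 LN = content s3 LN + (content s3 (LP i u) - content s3 LA) * (content s3 (LP i u) - content s3 LA) * content s3 (LX u)"
    using residual_arith[OF r3 u(2) s3(2-4) i(2)] by (auto simp: s4_def)
  have content1: "content s1 l = content s l" if "valid l" "l \<noteq> LA" for l
    using s1(1) that by (auto simp: effect_def)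
  have content3: "content s3 l = content s l" if "valid l" "l \<notin> {LA, LT}" for l
    using s2(1) s3(1) that content1 by (auto simp: effect_def)
  have "content s3 LA = (\<Sum>v<U. content s (LH u v) * content s (LX v) * content s (LP i v))"
    using s3(1) s2(2) u i by (auto simp: effect_def content1)
  then have w: "content s3 (LP i u) - content s3 LA = w"
    using u i by (simp add: w_def content3)
  have "effect {ri, ru} (1 + (1 + U * 10 + (4 + 4))) ?W s s4"
    by (intro effect_trans[of _ _ _ s s1] effect_trans[of _ _ _ s1 s2] effect_trans[of _ _ _ s2 s3]
        effect_mono[OF s1(1)] effect_mono[OF s2(1)] effect_mono[OF s3(1)] effect_mono[OF s4(1)]) auto
  moreover have "exec residual_body s = s4"
    by (simp add: residual_body_def s1_def s2_def s3_def s4_def)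
  ultimately show ?thesis
    using s4(2,3) u by (simp add: w content3 add.commute)
qed

section \<open>Stages of the program as kernel updates\<close>

definition stores ::
  "(nat \<Rightarrow> nat \<Rightarrow> real) \<Rightarrow> (nat \<Rightarrow> real) \<Rightarrow> (nat \<Rightarrow> nat \<Rightarrow> real) \<Rightarrow> machine_state \<Rightarrow> bool" where
  "stores P x K s \<longleftrightarrow>
     (\<forall>i<L. \<forall>u<U. content s (LP i u) = P i u) \<and> (\<forall>u<U. content s (LX u) = x u) \<and>
     (\<forall>u<U. \<forall>v<U. content s (LH u v) = K u v)"

lemma stores_cong: "stores P x K s \<Longrightarrow> content s' = content s \<Longrightarrow> stores P x K s'"
  by (simp add: stores_def)

lemma stores_effect:
  assumes "stores P x K s" "effect R n W s s'" and W: "W \<subseteq> range LG \<union> {LA, LT, LN}"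
  shows "stores P x K s'"
proof -
  have "LP i u \<notin> W" "LX u \<notin> W" "LH u v \<notin> W" for i u v
    using W by auto
  then show ?thesis
    using assms(1,2) by (simp add: stores_def effect_def)
qed

lemma residual_loop:
  assumes consistent: "consistent s" and i: "index s ri = i" "i < L" and stores: "stores P x K s"
  defines "w \<equiv> residual U P x K i"
  shows "effect {ri} (1 + U * (10 + U * 10 + 1)) (range LG \<union> {LA, LT, LN}) s (exec (Loop ru rU residual_body) s) \<and>
    (\<forall>u<U. content (exec (Loop ru rU residual_body) s) (LG u) = w u) \<and>
    content (exec (Loop ru rU residual_body) s) LN = content s LN + sqnorm U x w"
proof -
  let ?W = "range LG \<union> {LA, LT, LN}"
  let ?I = "\<lambda>k s'. (\<forall>u<k. content s' (LG u) = w u) \<and> content s' LN = content s LN + (\<Sum>u<k. w u * w u * x u)"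
  have "effect {ri} (1 + U * (10 + U * 10 + 1)) ?W s (exec (Loop ru rU residual_body) s) \<and>
      ?I U (exec (Loop ru rU residual_body) s)"
  proof (rule effect_Loop[where I = ?I])
    fix k s'
    assume k: "k < U" and s': "consistent s'" "index s' ru = k" "\<And>q. q \<in> {ri} \<Longrightarrow> index s' q = index s q"
      "\<And>l. valid l \<Longrightarrow> l \<notin> ?W \<Longrightarrow> content s' l = content s l" "?I k s'"
    have stores': "stores P x K s'"
      using stores s'(4) by (auto simp: stores_def)
    have ri: "index s' ri = i"
      using s'(3) i by auto
    have "content s' (LP i k) - (\<Sum>v<U. content s' (LH k v) * content s' (LX v) * content s' (LP i v)) = w k"
      using stores' k i by (simp add: stores_def w_def residual_def)
    then have b: "effect {ri, ru} (10 + U * 10) {LG k, LA, LT, LN} s' (exec residual_body s')"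
        "content (exec residual_body s') (LG k) = w k"
        "content (exec residual_body s') LN = content s' LN + w k * w k * content s' (LX k)"
      using residual_body[OF s'(1,2) k ri i(2)] by auto
    have "content (exec residual_body s') (LG u) = w u" if "u < k" for u
      using effect_content[OF b(1), of "LG u"] s'(5) that k by auto
    then have "?I (Suc k) (exec residual_body s')"
      using b s'(5) stores' k by (auto simp: less_Suc_eq stores_def)
    moreover have "effect {ri} (10 + U * 10) ?W s' (exec residual_body s')"
      using b(1) by (rule effect_mono) auto
    ultimately show "effect {ri} (10 + U * 10) ?W s' (exec residual_body s') \<and>
        ?I (Suc k) (exec residual_body s')"
      by blast
  qed (use consistent in \<open>auto simp: consistent_def\<close>)
  then show ?thesis
    by (auto simp: sqnorm_def)
qed

lemma update_row:
  assumes consistent: "consistent s" and u: "index s ru = u" "u < U" and nz: "content s LN \<noteq> 0"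
  shows "effect {ri, ru} (3 + U * 7) (range (LH u) \<union> {LA, LT}) s
      (exec (quotient_code ;; Loop rv rU update_body) s) \<and>
    (\<forall>v<U. content (exec (quotient_code ;; Loop rv rU update_body) s) (LH u v) =
      content s (LH u v) + content s (LG u) / content s LN * content s (LG v))"
proof -
  let ?W = "range (LH u) \<union> {LA, LT}"
  define t where "t = exec quotient_code s"
  have t: "effect {ri, ru} 2 {LA} s t" "content t LA = content s (LG u) / content s LN"
    using quotient_code[OF consistent u nz] by (auto simp: t_def)
  have t': "consistent t" "index t ru = u"
    using t(1) u by (auto simp: effect_def)
  have content_t: "content t l = content s l" if "valid l" "l \<noteq> LA" for l
    using t(1) that by (auto simp: effect_def)
  have "effect {ri, ru} (1 + U * (6 + 1)) (range (LH u) \<union> {LT}) t (exec (Loop rv rU update_body) t) \<and>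
    (\<forall>v<U. content (exec (Loop rv rU update_body) t) (LH u v) =
      content t (LH u v) + content t LA * content t (LG v))"
  proof (rule row_loop[OF t' _ u(2)])
    fix s' v
    assume v: "v < U" and s': "consistent s'" "index s' ru = u" "index s' rv = v"
      "\<And>l. valid l \<Longrightarrow> l \<notin> range (LH u) \<union> {LT} \<Longrightarrow> content s' l = content t l"
    have "content s' LA = content t LA" "content s' (LG v) = content t (LG v)"
      using s'(4) v by auto
    then show "effect {ri, ru} 6 {LH u v, LT} s' (exec update_body s') \<and>
        content (exec update_body s') (LH u v) = content s' (LH u v) + content t LA * content t (LG v)"
      using update_body[OF s'(1,2) u(2) s'(3) v] by simp
  qed
  then have b: "effect {ri, ru} (1 + U * 7) (range (LH u) \<union> {LT}) t (exec (Loop rv rU update_body) t)"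
    "\<forall>v<U. content (exec (Loop rv rU update_body) t) (LH u v) = content t (LH u v) + content t LA * content t (LG v)"
    by auto
  have "effect {ri, ru} (2 + (1 + U * 7)) ?W s (exec (Loop rv rU update_body) t)"
    by (intro effect_trans[of _ _ _ s t] effect_mono[OF t(1)] effect_mono[OF b(1)]) auto
  moreover have "2 + (1 + U * 7) = 3 + U * 7"
    by simp
  ultimately have "effect {ri, ru} (3 + U * 7) ?W s (exec (Loop rv rU update_body) t)"
    by (simp only:)
  then show ?thesis
    using b(2) u t(2) by (simp add: content_t t_def[symmetric])
qed

text \<open>The count is 1 for clearing \<open>LN\<close>, \<open>1 + U * (11 + U * 10)\<close> for
  the residual and \<open>1 + U * (4 + U * 7)\<close> for the update.\<close>

lemma stage_body:
  assumes consistent: "consistent s" and i: "index s ri = i" "i < L" and stores: "stores P x K s"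
  defines "w \<equiv> residual U P x K i"
  assumes nz: "sqnorm U x w \<noteq> 0"
  shows "effect {} (3 + U * 15 + U * U * 17) UNIV s (exec stage_body s) \<and>
    stores P x (\<lambda>u v. K u v + w u / sqnorm U x w * w v) (exec stage_body s)"
proof -
  define s1 where "s1 = exec (Real_Const rN 0) s"
  define s2 where "s2 = exec (Loop ru rU residual_body) s1"
  define s3 where "s3 = exec (Loop ru rU (quotient_code ;; Loop rv rU update_body)) s2"
  have s1: "effect {ri, ru} 1 {LN} s s1" "content s1 LN = 0"
    using zero_N[OF consistent] by (auto simp: s1_def)
  have r1: "consistent s1" "index s1 ri = i" "stores P x K s1"
    using s1(1) i stores_effect[OF stores s1(1)] by (auto simp: effect_def)
  have s2: "effect {ri} (1 + U * (10 + U * 10 + 1)) (range LG \<union> {LA, LT, LN}) s1 s2"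
    "\<forall>u<U. content s2 (LG u) = w u" "content s2 LN = sqnorm U x w"
    using residual_loop[OF r1(1,2) i(2) r1(3)] s1(2) by (auto simp: s2_def w_def)
  have r2: "consistent s2" "stores P x K s2"
    using s2(1) stores_effect[OF r1(3) s2(1)] by (auto simp: effect_def)
  have s3: "effect {ri} (1 + U * (3 + U * 7 + 1)) (matrix_cells \<union> {LA, LT}) s2 s3 \<and>
    (\<forall>u<U. \<forall>v<U. content s3 (LH u v) = content s2 (LH u v) + w u / sqnorm U x w * w v)"
    unfolding s3_def
  proof (rule matrix_loop[OF r2(1)])
    fix s' u
    assume u: "u < U" and s': "consistent s'" "index s' ru = u"
      "\<And>l. valid l \<Longrightarrow> l \<notin> matrix_cells \<union> {LA, LT} \<Longrightarrow> content s' l = content s2 l"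
    \<comment> \<open>The update writes neither the norm nor the residual row, so every row sees the
      values left by the residual loop.\<close>
    have "content s' LN = sqnorm U x w" and G: "\<forall>v<U. content s' (LG v) = w v"
      using s'(3) s2(2,3) by (auto simp: matrix_cells_def)
    then show "effect {ri, ru} (3 + U * 7) (range (LH u) \<union> {LA, LT}) s'
          (exec (quotient_code ;; Loop rv rU update_body) s') \<and>
        (\<forall>v<U. content (exec (quotient_code ;; Loop rv rU update_body) s') (LH u v) =
          content s' (LH u v) + w u / sqnorm U x w * w v)"
      using update_row[OF s'(1,2) u] nz u by simp
  qed
  have content3: "content s3 l = content s2 l" if "valid l" "l \<notin> matrix_cells \<union> {LA, LT}" for l
    using s3 that by (auto simp: effect_def)
  have "stores P x (\<lambda>u v. K u v + w u / sqnorm U x w * w v) s3"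
    using r2(2) s3 by (auto simp: stores_def content3 matrix_cells_def)
  moreover have "exec stage_body s = s3"
    by (simp add: stage_body_def s1_def s2_def s3_def)
  moreover have "effect {} (3 + U * 15 + U * U * 17) UNIV s s3"
    using s1(1) s2(1) s3 by (auto simp: effect_def algebra_simps)
  ultimately show ?thesis
    by simp
qed

lemma stage_loop:
  assumes consistent: "consistent s" and stores: "stores P x (\<lambda>_ _. 0) s" and pd: "pos_def L U P x"
  shows "\<exists>K. effect {} (1 + L * (3 + U * 15 + U * U * 17 + 1)) UNIV s (exec (Loop ri rL stage_body) s) \<and>
    stores P x K (exec (Loop ri rL stage_body) s) \<and> is_kernel L U P x K"
proof -
  let ?I = "\<lambda>k s'. \<exists>K. stores P x K s' \<and> is_kernel k U P x K"
  have "effect {} (1 + L * (3 + U * 15 + U * U * 17 + 1)) UNIV s (exec (Loop ri rL stage_body) s) \<and>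
    ?I L (exec (Loop ri rL stage_body) s)"
  proof (rule effect_Loop[where I = ?I])
    fix k s'
    assume k: "k < L" and s': "consistent s'" "index s' ri = k" "?I k s'"
    then obtain K where K: "stores P x K s'" "is_kernel k U P x K"
      by blast
    show "effect {} (3 + U * 15 + U * U * 17) UNIV s' (exec stage_body s') \<and>
        ?I (Suc k) (exec stage_body s')"
      \<comment> \<open>\<open>is_kernel_Suc\<close> supplies both the nonzero divisor and the next
        kernel.\<close>
      using stage_body[OF s'(1,2) k K(1)] is_kernel_Suc[OF K(2) k pd] by fastforce
  next
    show "?I k s''" if "?I k s'" "content s'' = content s'" for k s' s''
      using that stores_cong by blast
  qed (use consistent stores is_kernel_0 in \<open>auto simp: consistent_def\<close>)
  then show ?thesis
    by blast
qed

lemma gradient_loop: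
  assumes consistent: "consistent s"
  shows "effect {} (1 + U * 7) (range LG \<union> {LT}) s (exec (Loop ru rU gradient_body) s) \<and>
    (\<forall>u<U. content (exec (Loop ru rU gradient_body) s) (LG u) = - content s (LH u u))"
proof -
  let ?I = "\<lambda>k s'. \<forall>u<k. content s' (LG u) = - content s (LH u u)"
  have "effect {} (1 + U * (6 + 1)) (range LG \<union> {LT}) s (exec (Loop ru rU gradient_body) s) \<and>
      ?I U (exec (Loop ru rU gradient_body) s)"
  proof (rule effect_Loop[where I = ?I])
    fix k s'
    assume k: "k < U" and s': "consistent s'" "index s' ru = k"
      "\<And>l. valid l \<Longrightarrow> l \<notin> range LG \<union> {LT} \<Longrightarrow> content s' l = content s l" "?I k s'"
    have b: "effect {ri, ru} 6 {LG k, LT} s' (exec gradient_body s')"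
      "content (exec gradient_body s') (LG k) = - content s' (LH k k)"
      using gradient_body[OF s'(1,2) k] by auto
    have "content (exec gradient_body s') (LG u) = - content s (LH u u)" if "u < k" for u
      using effect_content[OF b(1), of "LG u"] s'(4) that k by auto
    then have "?I (Suc k) (exec gradient_body s')"
      using b(2) s'(3) k by (auto simp: less_Suc_eq)
    moreover have "effect {} 6 (range LG \<union> {LT}) s' (exec gradient_body s')"
      using b(1) by (rule effect_mono) auto
    ultimately show "effect {} 6 (range LG \<union> {LT}) s' (exec gradient_body s') \<and>
        ?I (Suc k) (exec gradient_body s')"
      by blast
  qed (use consistent in \<open>auto simp: consistent_def\<close>)
  then show ?thesis
    by simp
qed

lemma setup_code:
  assumes "index s = (\<lambda>_. 0)(0 := L, 1 := U)" "cells s = {}" "\<not> faulted s"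
  shows "effect {} 8 {} s (exec setup_code s)"
  using assms
  by (simp add: setup_code_def effect_def consistent_def content_def set_index_def XB_def GB_def HB_def)

lemma derivatives_program:
  assumes init: "index s = (\<lambda>_. 0)(0 := L, 1 := U)" "cells s = {}" "\<not> faulted s"
    and P: "\<And>i u. i < L \<Longrightarrow> u < U \<Longrightarrow> content s (LP i u) = P i u"
    and x: "\<And>u. u < U \<Longrightarrow> content s (LX u) = x u"
    and pd: "pos_def L U P x"
  shows "\<exists>K. is_kernel L U P x K \<and>
    effect {} (12 + 11 * U + 10 * U * U + L * (4 + U * 15 + U * U * 17)) UNIV s
      (exec derivatives_program s) \<and>
    (\<forall>u<U. content (exec derivatives_program s) (LG u) = - K u u) \<and>
    (\<forall>u<U. \<forall>v<U. content (exec derivatives_program s) (LH u v) = (K u v)\<^sup>2)"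
proof -
  define s1 where "s1 = exec setup_code s"
  define s2 where "s2 = exec (Loop ru rU (Loop rv rU clear_body)) s1"
  define s3 where "s3 = exec (Loop ri rL stage_body) s2"
  define s4 where "s4 = exec (Loop ru rU gradient_body) s3"
  define s5 where "s5 = exec (Loop ru rU (Loop rv rU square_body)) s4"
  have s1: "effect {} 8 {} s s1"
    unfolding s1_def by (rule setup_code[OF init])
  have s2: "effect {ri} (1 + U * (1 + U * (4 + 1) + 1)) (matrix_cells \<union> {LA, LT}) s1 s2 \<and>
    (\<forall>u<U. \<forall>v<U. content s2 (LH u v) = 0)"
    unfolding s2_def by (rule entrywise_loop[OF effect_consistent[OF s1] clear_body])
  have "content s2 l = content s l" if "valid l" "l \<notin> matrix_cells \<union> {LA, LT}" for l
    using s1 s2 that by (auto simp: effect_def)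
  then have "stores P x (\<lambda>_ _. 0) s2"
    using s2 P x by (auto simp: stores_def matrix_cells_def)
  moreover have g2: "consistent s2"
    using s2 by (auto simp: effect_def)
  ultimately obtain K where K: "is_kernel L U P x K" "stores P x K s3"
    and s3: "effect {} (1 + L * (3 + U * 15 + U * U * 17 + 1)) UNIV s2 s3"
    using stage_loop[OF _ _ pd] unfolding s3_def by blast
  have s4: "effect {} (1 + U * 7) (range LG \<union> {LT}) s3 s4 \<and> (\<forall>u<U. content s4 (LG u) = - content s3 (LH u u))"
    unfolding s4_def by (rule gradient_loop[OF effect_consistent[OF s3]])
  have s5: "effect {ri} (1 + U * (1 + U * (4 + 1) + 1)) (matrix_cells \<union> {LA, LT}) s4 s5 \<and>
    (\<forall>u<U. \<forall>v<U. content s5 (LH u v) = (content s4 (LH u v))\<^sup>2)"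
    unfolding s5_def using s4 by (intro entrywise_loop square_body) (auto simp: effect_def)
  have "content s4 (LH u v) = content s3 (LH u v)" if "u < U" "v < U" for u v
    using s4 that by (auto simp: effect_def)
  then have H: "\<forall>u<U. \<forall>v<U. content s5 (LH u v) = (K u v)\<^sup>2"
    using s5 K(2) by (auto simp: stores_def)
  have "content s5 (LG u) = content s4 (LG u)" if "u < U" for u
    using s5 that by (auto simp: effect_def matrix_cells_def)
  then have G: "\<forall>u<U. content s5 (LG u) = - K u u"
    using s4 K(2) by (auto simp: stores_def)
  \<comment> \<open>Setup takes 8 steps, clearing and squaring \<open>1 + 2 * U + 5 * U * U\<close>
    each, the gradient \<open>1 + 7 * U\<close>, and the rest is the loop over the stages.\<close>
  have "effect {} (12 + 11 * U + 10 * U * U + L * (4 + U * 15 + U * U * 17)) UNIV s s5"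
    using s1 s2 s3 s4 s5 by (auto simp: effect_def algebra_simps)
  moreover have "exec derivatives_program s = s5"
    by (simp add: derivatives_program_def s1_def s2_def s3_def s4_def s5_def)
  ultimately show ?thesis
    using K(1) G H by auto
qed

end

section \<open>Complexity of the derivatives of the barrier\<close>

lemma dimP_pos: "0 < dimP n r"
  by (simp add: dimP_def)

lemma computes_derivatives_mono:
  "computes_derivatives prog n d ps qs t m \<Longrightarrow> t \<le> t' \<Longrightarrow> m \<le> m' \<Longrightarrow>
    computes_derivatives prog n d ps qs t' m'"
  unfolding computes_derivatives_def Let_def by (meson lessThan_subset_iff order_trans)

lemma computes_derivatives_program:
  assumes ps: "ordered_basis n d ps" and qs: "lagrange_basis n (2 * d) ts qs"
    and L: "L = dimP n d" and U: "U = dimP n (2 * d)"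
  shows "computes_derivatives derivatives_program n d ps qs (70 * (L * U ^ 2)) (U ^ 2 + 70 * (L * U))"
proof -
  have len: "length ps = L" "length qs = U"
    using ps qs L U by (auto simp: ordered_basis_def lagrange_basis_def)
  have LU: "0 < L" "0 < U"
    by (simp_all add: L U dimP_pos)
  define P where "P i u = peval (ps ! i) (ts ! u)" for i u
  \<comment> \<open>As \<open>L\<close> and \<open>U\<close> are positive, every term is at most its
    coefficient times \<open>L * U ^ 2\<close>, and the coefficients add up to 69.\<close>
  have time: "12 + 11 * U + 10 * U * U + L * (4 + U * 15 + U * U * 17) \<le> 70 * (L * U ^ 2)"
  proof -
    have "1 \<le> L * U\<^sup>2" "U \<le> L * U\<^sup>2" "U * U \<le> L * U\<^sup>2" "L \<le> L * U\<^sup>2" "L * U \<le> L * U\<^sup>2"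
      using LU by (auto simp: power2_eq_square Suc_le_eq)
    then have "12 + 11 * U + 10 * (U * U) + 4 * L + 15 * (L * U) + 17 * (L * U\<^sup>2) \<le> 70 * (L * U\<^sup>2)"
      by linarith
    then show ?thesis
      by (simp add: algebra_simps power2_eq_square)
  qed
  \<comment> \<open>Input, gradient and the three single cells occupy
    \<open>L * U + 2 * U + 3\<close> cells, and the Hessian occupies \<open>U * U\<close>.\<close>
  have space: "HB L U + U * U + 3 \<le> U ^ 2 + 70 * (L * U)"
  proof -
    have "1 \<le> L * U" "U \<le> L * U"
      using LU by (auto simp: Suc_le_eq)
    then have "2 * U + 3 \<le> 69 * (L * U)"
      by linarith
    then show ?thesis
      by (simp add: HB_def GB_def XB_def power2_eq_square)
  qed
  show ?thesis
    unfolding computes_derivatives_def Let_def len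
  proof (intro ballI allI impI)
    fix x s
    assume x: "x \<in> Euclidean_space U interior_of dual_cone U (sos_cone n d qs)"
      and s: "initial_state ps qs x s"
    have pd: "pos_def L U P x"
      using pos_def_interior_dual_cone[OF ps qs] x by (simp add: len P_def[abs_def])
    \<comment> \<open>The basis elements have degree at most \<open>d\<close>, hence lie in the
      larger space where Lagrange coordinates are values.\<close>
    have repr: "mpoly.representation (set qs) (ps ! i) (qs ! u) = P i u" if "i < L" "u < U" for i u
      using that len ordered_basis_nth_polys[OF ps] polys_mono[of d "2 * d" n]
      by (subst lagrange_representation[OF qs]) (auto simp: P_def)
    have init: "index s = (\<lambda>_. 0)(0 := L, 1 := U)" "cells s = {}" "steps s = 0" "\<not> faulted s"
      "\<And>i u. i < L \<Longrightarrow> u < U \<Longrightarrow> content L U s (LP i u) = P i u"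
      "\<And>u. u < U \<Longrightarrow> content L U s (LX u) = x u"
      using s by (auto simp: initial_state_def Let_def len repr content_def XB_def)
    define s' where "s' = exec derivatives_program s"
    obtain K where K: "is_kernel L U P x K"
      and eff: "effect L U {} (12 + 11 * U + 10 * U * U + L * (4 + U * 15 + U * U * 17)) UNIV s s'"
      and G: "\<forall>u<U. content L U s' (LG u) = - K u u"
      and H: "\<forall>u<U. \<forall>v<U. content L U s' (LH u v) = (K u v)\<^sup>2"
      using derivatives_program[OF init(1,2,4,5,6) pd] unfolding s'_def by blast
    have barrier: "barrier ps qs = (\<lambda>x. - ln (Determinant.det (gram L U P x)))"
      by (simp add: barrier_def[abs_def] Lambda_eq_gram[OF ps qs] len P_def[abs_def])
    have "output_gradient L U s' u = - K u u" if "u < U" for u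
      using G that by (simp add: output_gradient_def content_def GB_def XB_def)
    then have 1: "has_gradient U (barrier ps qs) x (output_gradient L U s')"
      using gradient_hessian(1)[OF K det_gram_pos[OF pd] barrier] by (simp add: has_gradient_def)
    have "output_hessian L U s' u v = (K u v)\<^sup>2" if "u < U" "v < U" for u v
      using H that by (simp add: output_hessian_def content_def HB_def GB_def XB_def mult_2 add.assoc)
    then have 2: "has_hessian U (barrier ps qs) x (output_hessian L U s')"
      using gradient_hessian(2)[OF K det_gram_pos[OF pd] barrier] by (simp add: has_hessian_def)
    have "\<not> faulted s'" "cells s' \<subseteq> {..<U\<^sup>2 + 70 * (L * U)}"
      using eff space by (auto simp: effect_def consistent_def)
    moreover have "steps s' \<le> 70 * (L * U\<^sup>2)"
      using eff time by (simp add: effect_def init(3))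
    ultimately show "\<not> faulted (exec derivatives_program s) \<and>
        has_gradient U (barrier ps qs) x (output_gradient L U (exec derivatives_program s)) \<and>
        has_hessian U (barrier ps qs) x (output_hessian L U (exec derivatives_program s)) \<and>
        steps (exec derivatives_program s) \<le> 70 * (L * U\<^sup>2) \<and>
        cells (exec derivatives_program s) \<subseteq> {..<U\<^sup>2 + 70 * (L * U)}"
      using 1 2 by (simp add: s'_def)
  qed
qed

theorem theorem3p5:
  shows "\<exists>(prog :: program) (C :: nat).
    (\<forall>(n :: nat) (d :: nat) ps ts qs.
       ordered_basis n d ps \<and> lagrange_basis n (2 * d) ts qs \<longrightarrow>
       (let L = dimP n d; U = dimP n (2 * d) in
          computes_derivatives prog n d ps qs (C * (L * U ^ 2)) (U ^ 2 + C * (L * U)))) \<and>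
    (\<forall>(d :: nat) ps ts qs.
       1 \<le> d \<and> ordered_basis 1 d ps \<and> lagrange_basis 1 (2 * d) ts qs \<longrightarrow>
       computes_derivatives prog 1 d ps qs (C * d ^ 3) (C * d ^ 2))"
\<comment> \<open>The constant is \<open>70 * 2 * 3 ^ 2\<close>, coming from the univariate time
  bound with \<open>?L \<le> 2 * d\<close> and \<open>?U \<le> 3 * d\<close>.\<close>
proof (intro exI[of _ derivatives_program] exI[of _ 1260] conjI allI impI)
  fix n d ps ts qs
  assume "ordered_basis n d ps \<and> lagrange_basis n (2 * d) ts qs"
  then show "let L = dimP n d; U = dimP n (2 * d) in
      computes_derivatives derivatives_program n d ps qs (1260 * (L * U ^ 2)) (U ^ 2 + 1260 * (L * U))"
    unfolding Let_def
    by (intro computes_derivatives_mono[OF computes_derivatives_program[OF _ _ refl refl]]) auto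
next
  fix d :: nat and ps ts qs
  assume A: "1 \<le> d \<and> ordered_basis 1 d ps \<and> lagrange_basis 1 (2 * d) ts qs"
  let ?L = "dimP 1 d" and ?U = "dimP 1 (2 * d)"
  \<comment> \<open>The dimensions are \<open>d + 1\<close> and \<open>2 * d + 1\<close>; the bounds
    use \<open>1 \<le> d\<close>.\<close>
  have LU: "?L \<le> 2 * d" "?U \<le> 3 * d"
    using A by (auto simp: dimP_def)
  have "?L * ?U ^ 2 \<le> 2 * d * (3 * d) ^ 2" "?U ^ 2 \<le> (3 * d) ^ 2" "?L * ?U \<le> 2 * d * (3 * d)"
    by (intro mult_le_mono power_mono LU; simp)+
  then have "70 * (?L * ?U ^ 2) \<le> 1260 * d ^ 3" "?U ^ 2 + 70 * (?L * ?U) \<le> 1260 * d ^ 2"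
    by (simp_all add: power2_eq_square power3_eq_cube)
  then show "computes_derivatives derivatives_program 1 d ps qs (1260 * d ^ 3) (1260 * d ^ 2)"
    using A by (intro computes_derivatives_mono[OF computes_derivatives_program[OF _ _ refl refl]]) auto
qed

end
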